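(* Fix an integer $m\ge 2$, and let $\omega:\mathbb N\to\mathbb R$ be any function satisfying $\omega(n)\to\infty$ as $n\to\infty$. For each $n$ let $r=r(n)$ be a positive integer, and let $\chi_1,\dots,\chi_m:\binom{[n]}{2}\to C_r$ be independent uniformly random $r$-edge-colourings of the complete graph $K_n$. (a) If $$r\le \frac{m\binom n2}{2\log(n!)}+\frac{2m-1}{6}-\frac{\omega(n)}{(\log n)^2},$$ then with high probability there is no rainbow stacking of $\chi_1,\dots,\chi_m$. (b) If $$r\ge \frac{m\binom n2}{2\log(n!)}+\frac{2m-1}{6}+\frac{\omega(n)}{(\log n)^2},$$ then with high probability there is a rainbow stacking of $\chi_1,\dots,\chi_m$.
   Context: $[n]=\{1,\dots,n\}$; $K_n$ is the complete graph with vertex set $[n]$ and edge set $\binom{[n]}2$; $\mathfrak S_n$ is the symmetric group on $[n]$, acting on two-element subsets by $\sigma(\{u,v\})=\{\sigma(u),\sigma(v)\}$. $C_r$ is a palette of $r$ colours. "Independent uniformly random $r$-edge-colourings" means that all $m\binom n2$ colours $\chi_i(e)$ are independent and uniform on $C_r$. A rainbow stacking of $\chi_1,\dots,\chi_m$ is a tuple $\sigma=(\sigma_1,\dots,\sigma_m)\in\mathfrak S_n^m$ such that for every $e\in\binom{[n]}2$ the colours $\chi_1(\sigma_1^{-1}(e)),\dots,\chi_m(\sigma_m^{-1}(e))$ are pairwise distinct. "With high probability" (whp) means with probability tending to $1$ as $n\to\infty$, with $m$ fixed. $\log$ is the natural logarithm. *)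

theory Defs
  imports "HOL-Probability.Probability" "HOL-Probability.Product_PMF" "HOL-Library.Ramsey"
    "HOL-Combinatorics.Permutations"
begin

definition edges :: "nat \<Rightarrow> nat set set" where
  "edges n = nsets {1..n} 2"

(* The palette is {1..r}. The default values that Pi_pmf requires (0 off the edge set, and the
   constant 0 colouring off the index set {1..m}) are never inspected by rainbow_stacking. *)

definition random_colouring :: "nat \<Rightarrow> nat \<Rightarrow> (nat set \<Rightarrow> nat) pmf" where
  "random_colouring n r = Pi_pmf (edges n) 0 (\<lambda>_. pmf_of_set {1..r})"

definition random_colourings :: "nat \<Rightarrow> nat \<Rightarrow> nat \<Rightarrow> (nat \<Rightarrow> nat set \<Rightarrow> nat) pmf" where
  "random_colourings m n r = Pi_pmf {1..m} (\<lambda>_. 0) (\<lambda>_. random_colouring n r)"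

definition rainbow_stacking ::
    "nat \<Rightarrow> nat \<Rightarrow> (nat \<Rightarrow> nat set \<Rightarrow> nat) \<Rightarrow> (nat \<Rightarrow> nat \<Rightarrow> nat) \<Rightarrow> bool" where
  "rainbow_stacking m n c \<sigma> \<longleftrightarrow>
     (\<forall>i\<in>{1..m}. \<sigma> i permutes {1..n}) \<and>
     (\<forall>e\<in>edges n. inj_on (\<lambda>i. c i (inv (\<sigma> i) ` e)) {1..m})"

end

theory Submission
  imports Defs "HOL-Real_Asymp.Real_Asymp"
begin

text \<open>
Write \<open>E = n choose 2\<close>, \<open>L = ln (fact n)\<close>, \<open>T = m * E / (2 * L)\<close>, \<open>c = (2 * m - 1) / 6\<close>, and let \<open>q k\<close> be the
probability that \<open>k\<close> random colours are distinct.

A fixed tuple of permutations is rainbow with probability \<open>q m ^ E\<close>. A common relabelling of the target does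
not affect this property, so there are \<open>fact n ^ (m - 1)\<close> essentially different tuples. As
\<open>- ln (q m)\<close> is \<open>m * (m - 1) / 2 * (1 / r + c / r\<^sup>2)\<close> up to third order, the logarithm of the expected number
of different rainbow tuples is close to \<open>(m - 1) * L * (1 - T / r - c * T / r\<^sup>2)\<close>. This changes sign near \<open>r = T + c\<close>, and moving
\<open>r\<close> by \<open>\<epsilon>\<close> changes it by about \<open>(m - 1) * \<epsilon> * L / T\<close>, where \<open>L / T\<close> has order \<open>(ln n)\<^sup>2\<close>. Hence the expectation
tends to zero in the first case, which settles it (lemma \<open>subcritical\<close>).

In the second case the expectation tends to infinity, and it has to be shown that the second moment
of the number of rainbow tuples is asymptotically the square of the first. Three facts carry this.

\<^item> Two tuples \<open>\<sigma>\<close> and \<open>\<tau>\<close> form a bipartite multigraph on two copies of the edge set, in which each of the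
  \<open>m * E\<close> random colours joins its position under \<open>\<sigma>\<close> to its position under \<open>\<tau>\<close>. Both tuples are rainbow iff the
  colours form a proper edge colouring. Its probability is at most \<open>q m ^ (2 * E)\<close>, divided by \<open>q k\<close> for each
  set of \<open>k\<close> parallel edges, up to an error factor that tends to one, as cycles matter only to third order
  (lemma \<open>card_proper_colourings_pair_le\<close>).

\<^item> The bound \<open>1 / q k \<le> exp (l / m * (k * (k - 1)))\<close> turns the correction into the exponential of a sum over pairs of
  coordinates. By convexity it can be replaced by the sums over stars, whose terms are independent for random \<open>\<tau>\<close>.
  So the ratio of the moments is at most the power \<open>m - 1\<close> of the mean of \<open>exp (l * F)\<close>, where \<open>F\<close> is the number of edges
  that a uniformly random permutation of the vertices fixes (lemma \<open>overlap_sum_le\<close>).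

\<^item> This mean tends to one if \<open>l * E \<le> L - w\<close> with \<open>w\<close> tending to infinity, which the assumption on \<open>r\<close> provides.
  With \<open>f\<close> fixed points and \<open>t\<close> cycles of length two, \<open>F = (f choose 2) + t\<close>. As \<open>l\<close> is about \<open>2 * ln n / n\<close>, the
  cycles of length two are negligible, and \<open>f\<close> fixed points have probability at most \<open>1 / fact f\<close>. The excess of
  the mean over one is then governed by the sum of \<open>(exp (l * (f choose 2)) - 1) / fact f\<close>. Its terms are small for bounded
  \<open>f\<close> because \<open>l\<close> tends to zero, near \<open>f = n\<close> because of \<open>w\<close>, and in between because the factorial dominates
  (lemma \<open>fixed_edge_sum_asymp\<close>).
\<close>

section \<open>Proper colourings with respect to two partitions\<close>

text \<open>Think of the elements of \<open>X\<close> as the edges of a bipartite multigraph, where \<open>x\<close> joins the vertex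
\<open>\<alpha> x\<close> to the vertex \<open>\<beta> x\<close>; then these are its proper edge colourings. Taking \<open>\<beta> = \<alpha>\<close> leaves the
constraints of a single partition, so that one recursion serves the first and the second moment.\<close>

definition proper_colourings ::
    "('x \<Rightarrow> 'a) \<Rightarrow> ('x \<Rightarrow> 'b) \<Rightarrow> nat \<Rightarrow> 'x set \<Rightarrow> ('x \<Rightarrow> nat) set" where
  "proper_colourings \<alpha> \<beta> r X =
     {c \<in> X \<rightarrow>\<^sub>E {1..r}. \<forall>x\<in>X. \<forall>y\<in>X. x \<noteq> y \<longrightarrow> \<alpha> x = \<alpha> y \<or> \<beta> x = \<beta> y \<longrightarrow> c x \<noteq> c y}"

lemma finite_proper_colourings [simp]: "finite X \<Longrightarrow> finite (proper_colourings \<alpha> \<beta> r X)"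
  unfolding proper_colourings_def by (rule finite_subset[of _ "X \<rightarrow>\<^sub>E {1..r}"]) (auto intro: finite_PiE)

lemma proper_colourings_restrict:
  assumes "c \<in> proper_colourings \<alpha> \<beta> r X" "Y \<subseteq> X"
  shows "restrict c Y \<in> proper_colourings \<alpha> \<beta> r Y"
  using assms by (auto simp: proper_colourings_def PiE_iff subset_eq)

text \<open>A proper colouring of \<open>insert x X\<close> is a proper colouring of \<open>X\<close> together with a colour for \<open>x\<close> that no
neighbour of \<open>x\<close> has.\<close>

lemma card_proper_colourings_insert:
  assumes "finite X" "x \<notin> X"
  shows "card (proper_colourings \<alpha> \<beta> r (insert x X)) =
    (\<Sum>c\<in>proper_colourings \<alpha> \<beta> r X. card ({1..r} - c ` {y\<in>X. \<alpha> y = \<alpha> x \<or> \<beta> y = \<beta> x}))"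
proof -
  let ?P = "proper_colourings \<alpha> \<beta> r"
  let ?D = "SIGMA c:?P X. {1..r} - c ` {y\<in>X. \<alpha> y = \<alpha> x \<or> \<beta> y = \<beta> x}"
  let ?f = "\<lambda>(c, k). c(x := k)"
  have inj: "inj_on ?f ?D"
  proof (rule inj_onI, clarsimp)
    fix c k c' k'
    assume c: "c \<in> ?P X" "c' \<in> ?P X" and eq: "c(x := k) = c'(x := k')"
    have "c y = c' y" for y
      using fun_cong[OF eq, of y] c assms(2)
      by (cases "y = x") (auto simp: proper_colourings_def PiE_iff extensional_def)
    then show "c = c' \<and> k = k'" using fun_cong[OF eq, of x] by auto
  qed
  have "?f ` ?D = ?P (insert x X)"
  proof (intro equalityI subsetI)
    fix d assume "d \<in> ?f ` ?D"
    then obtain c k where d: "d = c(x := k)" and c: "c \<in> ?P X" "k \<in> {1..r}"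
      "k \<notin> c ` {y\<in>X. \<alpha> y = \<alpha> x \<or> \<beta> y = \<beta> x}" by auto
    show "d \<in> ?P (insert x X)"
      using c assms(2) unfolding d proper_colourings_def
      by (auto simp: PiE_iff extensional_def image_iff)
  next
    fix d assume d: "d \<in> ?P (insert x X)"
    have "d = (restrict d X)(x := d x)"
      using d by (auto simp: proper_colourings_def PiE_iff extensional_def fun_eq_iff)
    moreover have "(restrict d X, d x) \<in> ?D"
      using d assms(2) proper_colourings_restrict[OF d, of X]
      by (force simp: proper_colourings_def)
    ultimately show "d \<in> ?f ` ?D" by (metis (no_types, lifting) case_prod_conv image_eqI)
  qed
  then have "card (?P (insert x X)) = card ?D" using card_image[OF inj] by simp
  also have "\<dots> = (\<Sum>c\<in>?P X. card ({1..r} - c ` {y\<in>X. \<alpha> y = \<alpha> x \<or> \<beta> y = \<beta> x}))"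
    using assms by (intro card_SigmaI) auto
  finally show ?thesis .
qed

text \<open>The probability that \<open>k\<close> independent uniform colours out of \<open>r\<close> are pairwise distinct. It vanishes for
\<open>k > r\<close>, because of the factor \<open>j = r\<close>.\<close>

definition birthday :: "nat \<Rightarrow> nat \<Rightarrow> real" where
  "birthday r k = (\<Prod>j<k. 1 - real j / real r)"

lemma birthday_0 [simp]: "birthday r 0 = 1" and
  birthday_Suc: "birthday r (Suc k) = birthday r k * (1 - real k / real r)"
  by (simp_all add: birthday_def)

text \<open>The recursion of a product over all classes when an element joins \<open>X\<close>. Letting the product run over a
fixed set \<open>U\<close> of potential classes avoids a case distinction on whether the class of \<open>x\<close> is new.\<close>

lemma prod_birthday_insert:
  assumes "finite X" "x \<notin> X" "finite U" "\<alpha> x \<in> U"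
  shows "(\<Prod>v\<in>U. birthday r (card {y\<in>insert x X. \<alpha> y = v})) =
    (\<Prod>v\<in>U. birthday r (card {y\<in>X. \<alpha> y = v})) * (1 - real (card {y\<in>X. \<alpha> y = \<alpha> x}) / real r)"
proof -
  have ins: "{y\<in>insert x X. \<alpha> y = \<alpha> x} = insert x {y\<in>X. \<alpha> y = \<alpha> x}" by auto
  have other: "{y\<in>insert x X. \<alpha> y = v} = {y\<in>X. \<alpha> y = v}" if "v \<noteq> \<alpha> x" for v
    using that by auto
  have c: "card {y\<in>insert x X. \<alpha> y = \<alpha> x} = Suc (card {y\<in>X. \<alpha> y = \<alpha> x})"
    unfolding ins using assms by (subst card_insert_disjoint) auto
  have rest: "(\<Prod>v\<in>U - {\<alpha> x}. birthday r (card {y\<in>insert x X. \<alpha> y = v})) =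
      (\<Prod>v\<in>U - {\<alpha> x}. birthday r (card {y\<in>X. \<alpha> y = v}))"
    by (rule prod.cong[OF refl]) (use other in auto)
  show ?thesis
    unfolding prod.remove[OF assms(3,4)] c birthday_Suc rest by simp
qed

lemma proper_colourings_inj_on_class:
  assumes "c \<in> proper_colourings \<alpha> \<beta> r X"
  shows "inj_on c {y\<in>X. \<alpha> y = a}" "inj_on c {y\<in>X. \<beta> y = b}"
  using assms by (fastforce simp: proper_colourings_def intro!: inj_onI)+

text \<open>With one partition the choices in different classes are independent, which gives the exact count.\<close>

lemma card_proper_colourings_single:
  assumes "finite X" "finite U" "\<alpha> ` X \<subseteq> U" "r > 0"
  shows "real (card (proper_colourings \<alpha> \<alpha> r X)) =
    real r ^ card X * (\<Prod>v\<in>U. birthday r (card {y\<in>X. \<alpha> y = v}))"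
  using assms(1,3)
proof (induction X)
  case empty
  then show ?case by (simp add: proper_colourings_def)
next
  case (insert x X)
  let ?A = "{y\<in>X. \<alpha> y = \<alpha> x}"
  have "real (card ({1..r} - c ` {y\<in>X. \<alpha> y = \<alpha> x \<or> \<alpha> y = \<alpha> x})) = real r * (1 - real (card ?A) / real r)"
    if c: "c \<in> proper_colourings \<alpha> \<alpha> r X" for c
  proof -
    have sub: "c ` ?A \<subseteq> {1..r}" using c by (auto simp: proper_colourings_def PiE_iff)
    have "card (c ` ?A) = card ?A" using proper_colourings_inj_on_class(1)[OF c] by (rule card_image)
    then have "card ({1..r} - c ` ?A) = r - card ?A" "card ?A \<le> r"
      using sub insert.hyps card_mono[OF _ sub] by (simp_all add: card_Diff_subset finite_subset[OF sub])
    then show ?thesis using \<open>r > 0\<close> by (simp add: of_nat_diff field_simps)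
  qed
  then have "real (card (proper_colourings \<alpha> \<alpha> r (insert x X))) =
      real (card (proper_colourings \<alpha> \<alpha> r X)) * (real r * (1 - real (card ?A) / real r))"
    unfolding card_proper_colourings_insert[OF insert.hyps] of_nat_sum by simp
  also have "\<dots> = real r ^ card (insert x X) * (\<Prod>v\<in>U. birthday r (card {y\<in>insert x X. \<alpha> y = v}))"
    using insert assms(2) by (subst prod_birthday_insert) auto
  finally show ?case .
qed

text \<open>Under a uniformly random proper colouring, two elements agree with probability at most
\<open>1 / (r - 2 * m)\<close>: given the colours of all elements but \<open>y\<close>, the colour of \<open>y\<close> is uniform on at least
\<open>r - 2 * m\<close> colours.\<close>

lemma card_proper_colourings_coincide:
  assumes "finite X" "y \<in> X" "z \<in> X" "y \<noteq> z"
    and "card {w\<in>X. \<alpha> w = \<alpha> y} \<le> m" "card {w\<in>X. \<beta> w = \<beta> y} \<le> m" "2 * m < r"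
  shows "real (card {c \<in> proper_colourings \<alpha> \<beta> r X. c y = c z})
    \<le> real (card (proper_colourings \<alpha> \<beta> r X)) / (real r - 2 * real m)"
proof -
  let ?P = "proper_colourings \<alpha> \<beta> r" and ?Y = "X - {y}"
  have X: "X = insert y ?Y" using assms by auto
  \<comment> \<open>If \<open>c y = c z\<close>, then \<open>c\<close> can be recovered from its restriction to the other elements.\<close>
  have inj: "inj_on (\<lambda>c. restrict c ?Y) {c \<in> ?P X. c y = c z}"
  proof (rule inj_onI)
    fix c d assume c: "c \<in> {c \<in> ?P X. c y = c z}" and d: "d \<in> {c \<in> ?P X. c y = c z}"
      and eq: "restrict c ?Y = restrict d ?Y"
    have off: "c w = d w" if "w \<in> ?Y" for w using fun_cong[OF eq, of w] that by simp
    have cd: "c y = c z" "d y = d z" "c \<in> extensional X" "d \<in> extensional X"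
      using c d by (auto simp: proper_colourings_def PiE_def)
    have "c w = d w" for w
    proof -
      consider "w \<in> ?Y" | "w = y" | "w \<notin> X" by blast
      then show ?thesis
        using off[of w] off[of z] cd assms(3,4) by cases (auto simp: extensional_def)
    qed
    then show "c = d" by auto
  qed
  have "card {c \<in> ?P X. c y = c z} \<le> card (?P ?Y)"
    using inj by (rule card_inj_on_le) (use assms(1) in \<open>auto intro: proper_colourings_restrict\<close>)
  moreover have "real (card (?P ?Y)) * (real r - 2 * real m) \<le> real (card (?P X))"
  proof -
    have "real r - 2 * real m \<le> real (card ({1..r} - c ` {w\<in>?Y. \<alpha> w = \<alpha> y \<or> \<beta> w = \<beta> y}))" for c
    proof -
      have "card (c ` {w\<in>?Y. \<alpha> w = \<alpha> y \<or> \<beta> w = \<beta> y})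
          \<le> card ({w\<in>X. \<alpha> w = \<alpha> y} \<union> {w\<in>X. \<beta> w = \<beta> y})"
        using assms(1) by (intro order.trans[OF card_image_le] card_mono) auto
      also have "\<dots> \<le> 2 * m" using assms(5,6) by (intro order.trans[OF card_Un_le]) simp
      finally have "card (c ` {w\<in>?Y. \<alpha> w = \<alpha> y \<or> \<beta> w = \<beta> y}) \<le> 2 * m" .
      moreover have "r - card (c ` {w\<in>?Y. \<alpha> w = \<alpha> y \<or> \<beta> w = \<beta> y})
          \<le> card ({1..r} - c ` {w\<in>?Y. \<alpha> w = \<alpha> y \<or> \<beta> w = \<beta> y})"
        using diff_card_le_card_Diff[of "c ` {w\<in>?Y. \<alpha> w = \<alpha> y \<or> \<beta> w = \<beta> y}" "{1..r}"] assms(1) by simp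
      ultimately have "r \<le> card ({1..r} - c ` {w\<in>?Y. \<alpha> w = \<alpha> y \<or> \<beta> w = \<beta> y}) + 2 * m" by linarith
      then show ?thesis by linarith
    qed
    then have "(\<Sum>c\<in>?P ?Y. real r - 2 * real m)
        \<le> (\<Sum>c\<in>?P ?Y. real (card ({1..r} - c ` {w\<in>?Y. \<alpha> w = \<alpha> y \<or> \<beta> w = \<beta> y})))"
      by (rule sum_mono)
    also have "\<dots> = real (card (?P X))"
      using assms(1) card_proper_colourings_insert[of ?Y y \<alpha> \<beta> r] X by simp
    finally show ?thesis by simp
  qed
  ultimately have "real (card {c \<in> ?P X. c y = c z}) * (real r - 2 * real m) \<le> real (card (?P X))"
    using assms(7) mult_right_mono[of "real (card {c \<in> ?P X. c y = c z})" "real (card (?P ?Y))" "real r - 2 * real m"]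
    by linarith
  then show ?thesis using assms(7) by (subst pos_le_divide_eq) auto
qed

text \<open>Here \<open>a\<close> and \<open>b\<close> are the numbers of coloured neighbours of a new element in its two classes and \<open>s\<close> is
the number of common ones. The left side bounds the probability that a random colour suits the new
element, the right side is the value for a multigraph without cycles, up to an error of third order
in \<open>1 / r\<close>. Agreement up to the second order is essential: near the threshold there are \<open>m * (n choose 2)\<close> such factors and \<open>r\<close> is about
\<open>m * n / (4 * ln n)\<close>, so that errors of second order would not be negligible in the product.\<close>

lemma coincidence_factor_bound:
  fixes a b s M r :: real
  assumes "0 \<le> s" "s \<le> a" "s \<le> b" "a \<le> M" "b \<le> M" "4 * M \<le> r" "0 < r"
  shows "1 - (a + b - s) / r + (a - s) * (b - s) / (r * (r - 2 * M))
    \<le> (1 - a / r) * (1 - b / r) / (1 - s / r) * (1 + 8 * M ^ 3 / r ^ 3)"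
proof -
  define T where "T = (1 - a / r) * (1 - b / r) / (1 - s / r)"
  have M0: "0 \<le> M" using assms by linarith
  have frac: "0 \<le> x / r" "x / r \<le> 1/4" if "0 \<le> x" "x \<le> M" for x
    using that assms by (auto simp: field_simps)
  have sr: "0 \<le> s / r" "s / r \<le> 1/4" and ar: "a / r \<le> 1/4" and br: "b / r \<le> 1/4"
    using frac[of s] frac[of a] frac[of b] assms by auto
  have "(1/2) \<le> (3/4) * (3/4::real)" by simp
  also have "\<dots> \<le> (1 - a / r) * (1 - b / r)" using ar br by (intro mult_mono) linarith+
  also have "\<dots> \<le> T"
  proof -
    have "(1 - a / r) * (1 - b / r) \<ge> 0" using ar br by (intro mult_nonneg_nonneg) linarith+
    then have "(1 - a / r) * (1 - b / r) * (1 - s / r) \<le> (1 - a / r) * (1 - b / r)"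
      using sr by (intro mult_left_le) linarith+
    moreover have "0 < 1 - s / r" using sr by linarith
    ultimately show ?thesis unfolding T_def by (subst pos_le_divide_eq)
  qed
  finally have T: "1/2 \<le> T" .
  \<comment> \<open>The products of the two sides with \<open>1 - s / r\<close> agree except for a term of third order with a favourable sign.\<close>
  have "(1 - s / r) * (1 - (a + b - s) / r + (a - s) * (b - s) / r\<^sup>2)
      = (1 - a / r) * (1 - b / r) - s * (a - s) * (b - s) / r ^ 3"
    using assms(7) by (simp add: field_simps power2_eq_square power3_eq_cube)
  moreover have "0 \<le> s * (a - s) * (b - s) / r ^ 3" using assms by simp
  ultimately have main: "1 - (a + b - s) / r + (a - s) * (b - s) / r\<^sup>2 \<le> T"
    unfolding T_def using sr by (subst pos_le_divide_eq) (linarith, simp add: mult.commute)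
  have "1 / (r * (r - 2 * M)) \<le> 1 / r\<^sup>2 + 4 * M / r ^ 3"
  proof -
    have p: "0 < r - 2 * M" "r / 2 \<le> r - 2 * M" using assms by auto
    have "1 / (r * (r - 2 * M)) - 1 / r\<^sup>2 = (2 * M / r\<^sup>2) * (1 / (r - 2 * M))"
      using p assms(7) by (simp add: field_simps power2_eq_square)
    also have "\<dots> \<le> (2 * M / r\<^sup>2) * (1 / (r / 2))"
      using p assms(7) M0 by (intro mult_left_mono divide_left_mono) auto
    also have "\<dots> = 4 * M / r ^ 3" by (simp add: power2_eq_square power3_eq_cube)
    finally show ?thesis by simp
  qed
  then have "(a - s) * (b - s) * (1 / (r * (r - 2 * M))) \<le> (a - s) * (b - s) * (1 / r\<^sup>2 + 4 * M / r ^ 3)"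
    using assms by (intro mult_left_mono) auto
  also have "\<dots> = (a - s) * (b - s) / r\<^sup>2 + (a - s) * (b - s) * (4 * M / r ^ 3)"
    by (simp add: distrib_left)
  also have "(a - s) * (b - s) * (4 * M / r ^ 3) \<le> M * M * (4 * M / r ^ 3)"
    using assms M0 by (intro mult_right_mono mult_mono) auto
  also have "M * M * (4 * M / r ^ 3) = 1/2 * (8 * M ^ 3 / r ^ 3)" by (simp add: power3_eq_cube)
  also have "\<dots> \<le> T * (8 * M ^ 3 / r ^ 3)"
    using T M0 assms by (intro mult_right_mono) auto
  finally have "(a - s) * (b - s) / (r * (r - 2 * M)) \<le> (a - s) * (b - s) / r\<^sup>2 + T * (8 * M ^ 3 / r ^ 3)"
    by simp
  then show ?thesis using main unfolding T_def[symmetric] by (simp add: algebra_simps)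
qed


text \<open>The count for two partitions. If the multigraph has no cycles apart from multiple edges, then the
classes contribute independently, except that a set of \<open>k\<close> parallel edges is asked twice to have
distinct colours, and the bound without its last factor is exact. Cycles can only
matter through coincidences between elements that are not adjacent, and such a coincidence has
probability at most \<open>1 / (r - 2 * m)\<close>, close to the value \<open>1 / r\<close> for independent colours. The proof
colours one element at a time.\<close>

lemma card_proper_colourings_pair_le:
  assumes "finite X" "finite U" "finite V" "\<alpha> ` X \<subseteq> U" "\<beta> ` X \<subseteq> V" "4 * m \<le> r" "0 < m"
    and "\<And>x. x \<in> X \<Longrightarrow> card {y\<in>X. \<alpha> y = \<alpha> x} \<le> m" "\<And>x. x \<in> X \<Longrightarrow> card {y\<in>X. \<beta> y = \<beta> x} \<le> m"
  shows "real (card (proper_colourings \<alpha> \<beta> r X)) \<le> real r ^ card X *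
    ((\<Prod>v\<in>U. birthday r (card {y\<in>X. \<alpha> y = v})) * (\<Prod>v\<in>V. birthday r (card {y\<in>X. \<beta> y = v}))
      / (\<Prod>v\<in>U\<times>V. birthday r (card {y\<in>X. (\<alpha> y, \<beta> y) = v}))) * (1 + 8 * real m ^ 3 / real r ^ 3) ^ card X"
  using assms(1,4,5,8,9)
proof (induction X)
  case empty
  then show ?case by (simp add: proper_colourings_def)
next
  case (insert x X)
  let ?P = "proper_colourings \<alpha> \<beta> r"
  define A where "A = {y\<in>X. \<alpha> y = \<alpha> x}"
  define B where "B = {y\<in>X. \<beta> y = \<beta> x}"
  define S where "S = {y\<in>X. (\<alpha> y, \<beta> y) = (\<alpha> x, \<beta> x)}"
  have S: "S = A \<inter> B" by (auto simp: A_def B_def S_def)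
  have fin: "finite A" "finite B" "finite S" using insert.hyps by (simp_all add: A_def B_def S_def)
  define a b s where "a = real (card A)" and "b = real (card B)" and "s = real (card S)"
  define N where "N = real (card (?P X))"
  define R where "R = real r"
  define M where "M = real m"
  have r0: "r > 0" using assms(6,7) by linarith
  have R0: "R > 0" and R4: "4 * M \<le> R" and M0: "M > 0"
    using assms(6,7) by (simp_all add: R_def M_def)
  have cardm: "card {y\<in>X. \<alpha> y = \<alpha> w} \<le> m" "card {y\<in>X. \<beta> y = \<beta> w} \<le> m" if "w \<in> X" for w
    using insert.prems(3,4)[of w] that insert.hyps
    by (auto intro!: order.trans[OF card_mono, of "{y\<in>insert x X. \<alpha> y = \<alpha> w}" "{y\<in>X. \<alpha> y = \<alpha> w}"]
        order.trans[OF card_mono, of "{y\<in>insert x X. \<beta> y = \<beta> w}" "{y\<in>X. \<beta> y = \<beta> w}"])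
  have "card A \<le> card {y\<in>insert x X. \<alpha> y = \<alpha> x}" "card B \<le> card {y\<in>insert x X. \<beta> y = \<beta> x}"
    unfolding A_def B_def using insert.hyps by (auto intro!: card_mono)
  then have "card A \<le> m" "card B \<le> m"
    using insert.prems(3,4)[of x] by auto
  then have aM: "a \<le> M" and bM: "b \<le> M" by (auto simp: a_def b_def M_def)
  have s: "0 \<le> s" "s \<le> a" "s \<le> b"
    unfolding s_def a_def b_def S using fin by (auto intro: card_mono)
  \<comment> \<open>The colours forbidden to \<open>x\<close> are those on \<open>A \<union> B\<close>; they are fewer than \<open>a + b - s\<close> only when some pair in \<open>Z\<close> agrees.\<close>
  define Z where "Z = (A - S) \<times> (B - S)"
  have finZ: "finite Z" using fin by (simp add: Z_def)
  have cardZ: "real (card Z) = (a - s) * (b - s)"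
    unfolding Z_def card_cartesian_product a_def b_def s_def
    using fin by (subst (1 2) card_Diff_subset) (auto simp: S of_nat_diff card_mono)
  have step: "real (card ({1..r} - c ` {y\<in>X. \<alpha> y = \<alpha> x \<or> \<beta> y = \<beta> x}))
      \<le> (R - (a + b - s)) + (\<Sum>p\<in>Z. if c (fst p) = c (snd p) then 1 else 0)" if c: "c \<in> ?P X" for c
  proof -
    have AB: "{y\<in>X. \<alpha> y = \<alpha> x \<or> \<beta> y = \<beta> x} = A \<union> B" by (auto simp: A_def B_def)
    have sub: "c ` (A \<union> B) \<subseteq> {1..r}"
      using c by (auto simp: proper_colourings_def PiE_iff A_def B_def)
    have cA: "card (c ` A) = card A" and cB: "card (c ` B) = card B"
      using proper_colourings_inj_on_class[OF c] by (auto simp: A_def B_def intro: card_image)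
    let ?Z = "{p\<in>Z. c (fst p) = c (snd p)}"
    have "c ` A \<inter> c ` B \<subseteq> c ` S \<union> (\<lambda>p. c (fst p)) ` ?Z"
    proof
      fix k assume "k \<in> c ` A \<inter> c ` B"
      then obtain y z where y: "y \<in> A" "k = c y" and z: "z \<in> B" "k = c z" by auto
      show "k \<in> c ` S \<union> (\<lambda>p. c (fst p)) ` ?Z"
      proof (cases "y \<in> S \<or> z \<in> S")
        case False
        then have "(y, z) \<in> ?Z" using y z by (auto simp: Z_def)
        then show ?thesis using y by force
      next
        case True
        then have "k \<in> c ` S" using y(2) z(2) by blast
        then show ?thesis by blast
      qed
    qed
    then have "card (c ` A \<inter> c ` B) \<le> card (c ` S \<union> (\<lambda>p. c (fst p)) ` ?Z)"
      using fin finZ by (intro card_mono) auto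
    also have "\<dots> \<le> card S + card ?Z"
      using fin finZ by (intro order.trans[OF card_Un_le] add_mono card_image_le) auto
    finally have int: "card (c ` A \<inter> c ` B) \<le> card S + card ?Z" .
    have "card A + card B = card (c ` (A \<union> B)) + card (c ` A \<inter> c ` B)"
      unfolding image_Un using card_Un_Int[of "c ` A" "c ` B"] fin cA cB by simp
    moreover have "card ({1..r} - c ` (A \<union> B)) = r - card (c ` (A \<union> B))"
      using fin sub by (subst card_Diff_subset) auto
    moreover have "card (c ` (A \<union> B)) \<le> r" using card_mono[OF _ sub] by simp
    ultimately have "card ({1..r} - c ` (A \<union> B)) + card A + card B \<le> r + card S + card ?Z"
      using int by linarith
    then have "real (card ({1..r} - c ` (A \<union> B))) + a + b \<le> R + s + real (card ?Z)"
      unfolding a_def b_def s_def R_def by linarith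
    moreover have "real (card ?Z) = (\<Sum>p\<in>Z. if c (fst p) = c (snd p) then 1 else 0)"
      using finZ by (simp add: sum.If_cases Int_def)
    ultimately show ?thesis unfolding AB by linarith
  qed
  have coin: "(\<Sum>c\<in>?P X. if c (fst p) = c (snd p) then 1 else 0) \<le> N / (R - 2 * M)" if p: "p \<in> Z" for p
  proof -
    have "fst p \<in> X" "snd p \<in> X" "fst p \<noteq> snd p" using p S by (auto simp: Z_def A_def B_def)
    then have "real (card {c \<in> ?P X. c (fst p) = c (snd p)}) \<le> N / (R - 2 * M)"
      unfolding N_def R_def M_def using insert.hyps cardm assms(6,7)
      by (intro card_proper_colourings_coincide) auto
    then show ?thesis using insert.hyps by (simp add: sum.If_cases Int_def)
  qed
  have pa: "(\<Prod>v\<in>U. birthday r (card {y\<in>insert x X. \<alpha> y = v})) =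
      (\<Prod>v\<in>U. birthday r (card {y\<in>X. \<alpha> y = v})) * (1 - real (card {y\<in>X. \<alpha> y = \<alpha> x}) / real r)"
    and pb: "(\<Prod>v\<in>V. birthday r (card {y\<in>insert x X. \<beta> y = v})) =
      (\<Prod>v\<in>V. birthday r (card {y\<in>X. \<beta> y = v})) * (1 - real (card {y\<in>X. \<beta> y = \<beta> x}) / real r)"
    and pab: "(\<Prod>v\<in>U\<times>V. birthday r (card {y\<in>insert x X. (\<alpha> y, \<beta> y) = v})) =
      (\<Prod>v\<in>U\<times>V. birthday r (card {y\<in>X. (\<alpha> y, \<beta> y) = v})) *
        (1 - real (card {y\<in>X. (\<alpha> y, \<beta> y) = (\<alpha> x, \<beta> x)}) / real r)"
    using insert.prems(1,2) assms(2,3) insert.hyps by - (rule prod_birthday_insert; auto)+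
  have "real (card (?P (insert x X))) \<le>
      (\<Sum>c\<in>?P X. (R - (a + b - s)) + (\<Sum>p\<in>Z. if c (fst p) = c (snd p) then 1 else 0))"
    unfolding card_proper_colourings_insert[OF insert.hyps] of_nat_sum by (intro sum_mono step)
  also have "\<dots> = N * (R - (a + b - s)) + (\<Sum>p\<in>Z. \<Sum>c\<in>?P X. if c (fst p) = c (snd p) then 1 else 0)"
    unfolding sum.distrib N_def by (subst (2) sum.swap) simp
  also have "\<dots> \<le> N * (R - (a + b - s)) + (\<Sum>p\<in>Z. N / (R - 2 * M))"
    by (intro add_left_mono sum_mono coin)
  also have "\<dots> = N * R * (1 - (a + b - s) / R + (a - s) * (b - s) / (R * (R - 2 * M)))"
    using R0 R4 M0 by (simp add: cardZ field_simps)
  also have "\<dots> \<le> N * R * ((1 - a / R) * (1 - b / R) / (1 - s / R) * (1 + 8 * M ^ 3 / R ^ 3))"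
    using s aM bM R0 R4 by (intro mult_left_mono coincidence_factor_bound) (auto simp: N_def)
  also have "\<dots> \<le> (R ^ card X *
    ((\<Prod>v\<in>U. birthday r (card {y\<in>X. \<alpha> y = v})) * (\<Prod>v\<in>V. birthday r (card {y\<in>X. \<beta> y = v}))
      / (\<Prod>v\<in>U\<times>V. birthday r (card {y\<in>X. (\<alpha> y, \<beta> y) = v}))) * (1 + 8 * M ^ 3 / R ^ 3) ^ card X)
      * R * ((1 - a / R) * (1 - b / R) / (1 - s / R) * (1 + 8 * M ^ 3 / R ^ 3))"
  proof (intro mult_right_mono)
    have "a / R \<le> 1" "b / R \<le> 1" "s / R \<le> 1" using s aM bM R4 R0 M0 by (simp_all add: divide_le_eq)
    then show "0 \<le> (1 - a / R) * (1 - b / R) / (1 - s / R) * (1 + 8 * M ^ 3 / R ^ 3)"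
      using M0 R0 by simp
    show "N \<le> R ^ card X *
    ((\<Prod>v\<in>U. birthday r (card {y\<in>X. \<alpha> y = v})) * (\<Prod>v\<in>V. birthday r (card {y\<in>X. \<beta> y = v}))
      / (\<Prod>v\<in>U\<times>V. birthday r (card {y\<in>X. (\<alpha> y, \<beta> y) = v}))) * (1 + 8 * M ^ 3 / R ^ 3) ^ card X"
      unfolding N_def R_def M_def using insert.prems cardm by (intro insert.IH) auto
  qed (use R0 in simp)
  also have "R ^ card X *
    ((\<Prod>v\<in>U. birthday r (card {y\<in>X. \<alpha> y = v})) * (\<Prod>v\<in>V. birthday r (card {y\<in>X. \<beta> y = v}))
      / (\<Prod>v\<in>U\<times>V. birthday r (card {y\<in>X. (\<alpha> y, \<beta> y) = v}))) * (1 + 8 * M ^ 3 / R ^ 3) ^ card X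
      * R * ((1 - a / R) * (1 - b / R) / (1 - s / R) * (1 + 8 * M ^ 3 / R ^ 3)) =
    real r ^ card (insert x X) *
    ((\<Prod>v\<in>U. birthday r (card {y\<in>insert x X. \<alpha> y = v})) * (\<Prod>v\<in>V. birthday r (card {y\<in>insert x X. \<beta> y = v}))
      / (\<Prod>v\<in>U\<times>V. birthday r (card {y\<in>insert x X. (\<alpha> y, \<beta> y) = v}))) * (1 + 8 * real m ^ 3 / real r ^ 3) ^ card (insert x X)"
    unfolding pa pb pab card_insert_disjoint[OF insert.hyps] a_def b_def s_def A_def B_def S_def R_def M_def
    by (simp add: mult_ac)
  finally show ?case .
qed

section \<open>Probabilities of distinct colours\<close>

lemma ln_one_minus_le:
  fixes x :: real
  assumes "0 \<le> x" "x < 1"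
  shows "ln (1 - x) \<le> - x - x\<^sup>2 / 2"
proof -
  define f where "f x = ln (1 - x) + x + x\<^sup>2 / 2" for x :: real
  have "f x \<le> f 0"
  proof (rule DERIV_nonpos_imp_nonincreasing[OF assms(1)])
    fix t :: real assume t: "0 \<le> t" "t \<le> x"
    have "DERIV f t :> - (1 / (1 - t)) + 1 + t"
      unfolding f_def using t assms by (auto intro!: derivative_eq_intros simp: field_simps)
    moreover have "- (1 / (1 - t)) + 1 + t = - (t\<^sup>2 / (1 - t))"
      using t assms by (simp add: field_simps power2_eq_square)
    moreover have "- (t\<^sup>2 / (1 - t)) \<le> 0" using t assms by simp
    ultimately show "\<exists>y. DERIV f t :> y \<and> y \<le> 0" by metis
  qed
  then show ?thesis by (simp add: f_def)
qed

lemma ln_one_minus_ge: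
  fixes x :: real
  assumes "0 \<le> x" "x \<le> 1/2"
  shows "- x - x\<^sup>2 / 2 - x ^ 3 \<le> ln (1 - x)"
proof -
  define f where "f x = ln (1 - x) + x + x\<^sup>2 / 2 + x ^ 3" for x :: real
  have "f 0 \<le> f x"
  proof (rule DERIV_nonneg_imp_nondecreasing[OF assms(1)])
    fix t :: real assume t: "0 \<le> t" "t \<le> x"
    have "DERIV f t :> - (1 / (1 - t)) + 1 + t + 3 * t\<^sup>2"
      unfolding f_def using t assms by (auto intro!: derivative_eq_intros simp: field_simps)
    moreover have "- (1 / (1 - t)) + 1 + t + 3 * t\<^sup>2 = t\<^sup>2 * (2 - 3 * t) / (1 - t)"
      using t assms by (simp add: field_simps power2_eq_square)
    moreover have "0 \<le> t\<^sup>2 * (2 - 3 * t) / (1 - t)" using t assms by simp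
    ultimately show "\<exists>y. DERIV f t :> y \<and> 0 \<le> y" by metis
  qed
  then show ?thesis by (simp add: f_def)
qed

lemma sum_lessThan_real: "(\<Sum>j<k. real j) = real k * (real k - 1) / 2"
  by (induction k) (auto simp: field_simps)

lemma sum_squares_lessThan_real: "(\<Sum>j<k. (real j)\<^sup>2) = real k * (real k - 1) * (2 * real k - 1) / 6"
  by (induction k) (auto simp: field_simps power2_eq_square)

lemma birthday_pos: "k \<le> r \<Longrightarrow> 0 < birthday r k"
  unfolding birthday_def by (intro prod_pos) (auto simp: field_simps)

lemma birthday_eq_0: "r > 0 \<Longrightarrow> r < m \<Longrightarrow> birthday r m = 0"
  by (auto simp: birthday_def intro!: bexI[of _ r])

lemma birthday_nonneg: "r > 0 \<Longrightarrow> 0 \<le> birthday r m"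
  using birthday_pos[of m r] birthday_eq_0[of r m] by (cases "m \<le> r") auto

text \<open>The first two orders of \<open>ln (1 - x)\<close> turn the product into power sums; the second one is the source of the
term \<open>(2 * m - 1) / 6\<close> in the threshold.\<close>

lemma birthday_le:
  assumes "r > 0"
  shows "birthday r m \<le> exp (- (real m * (real m - 1) / 2 * (1 / real r + (2 * real m - 1) / 6 / (real r)\<^sup>2)))"
proof (cases "m \<le> r")
  case False
  then show ?thesis using assms by (simp add: birthday_eq_0)
next
  case True
  have "birthday r m \<le> (\<Prod>j<m. exp (- (real j / real r) - (real j / real r)\<^sup>2 / 2))"
    unfolding birthday_def
  proof (intro prod_mono conjI)
    fix j assume "j \<in> {..<m}"
    then have j: "0 \<le> real j / real r" "real j / real r < 1" using True assms by auto
    show "0 \<le> 1 - real j / real r" using j by simp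
    show "1 - real j / real r \<le> exp (- (real j / real r) - (real j / real r)\<^sup>2 / 2)"
      using ln_one_minus_le[OF j] j by (subst ln_le_cancel_iff[symmetric]) auto
  qed
  also have "\<dots> = exp (\<Sum>j<m. - (real j / real r) - (real j / real r)\<^sup>2 / 2)"
    by (simp add: exp_sum)
  also have "(\<Sum>j<m. - (real j / real r) - (real j / real r)\<^sup>2 / 2) =
      - ((\<Sum>j<m. real j) / real r + (\<Sum>j<m. (real j)\<^sup>2) / (2 * (real r)\<^sup>2))"
    by (simp add: sum_subtractf sum_negf sum_divide_distrib power_divide mult.commute)
  also have "\<dots> = - (real m * (real m - 1) / 2 * (1 / real r + (2 * real m - 1) / 6 / (real r)\<^sup>2))"
    unfolding sum_lessThan_real sum_squares_lessThan_real using assms by (simp add: field_simps)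
  finally show ?thesis .
qed

text \<open>This bounds \<open>m / (k * (k - 1))\<close> times \<open>- ln (birthday r k)\<close> for all \<open>k\<close> with \<open>2 \<le> k \<le> m\<close>
once \<open>r \<ge> 4 * m\<close>. At \<open>k = m\<close> the first
two orders in \<open>1 / r\<close> are attained, so that no constant factor is lost for pairs of stackings that agree on
most edges.\<close>

definition pair_weight :: "nat \<Rightarrow> real \<Rightarrow> real" where
  "pair_weight m r = real m * (1 / (2 * r) + (2 * real m - 1) / (12 * r\<^sup>2) + (real m)\<^sup>2 / r ^ 3)"

text \<open>The penalty for \<open>k\<close> parallel edges, written as a sum over ordered pairs of them. This form is what lets
the second moment be split into contributions of pairs of coordinates.\<close>

lemma inverse_birthday_le:
  assumes "k \<le> m" "4 * m \<le> r" "0 < m"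
  shows "1 / birthday r k \<le> exp (pair_weight m r / m * (real k * (real k - 1)))"
proof -
  have r0: "real r > 0" using assms by simp
  define g where "g j = real j / real r + (real j / real r)\<^sup>2 / 2 + (real j / real r) ^ 3" for j :: nat
  have "exp (- (\<Sum>j<k. g j)) = (\<Prod>j<k. exp (- g j))"
    by (simp add: exp_sum sum_negf[symmetric])
  also have "\<dots> \<le> birthday r k"
    unfolding birthday_def
  proof (intro prod_mono conjI)
    fix j assume "j \<in> {..<k}"
    then have j: "0 \<le> real j / real r" "real j / real r \<le> 1/2" using assms r0 by (auto simp: field_simps)
    then have "- g j \<le> ln (1 - real j / real r)" using ln_one_minus_ge[OF j] by (simp add: g_def)
    then show "exp (- g j) \<le> 1 - real j / real r" using j by (subst (asm) ln_ge_iff) linarith+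
  qed simp
  finally have "exp (- (\<Sum>j<k. g j)) \<le> birthday r k" .
  then have "1 / birthday r k \<le> exp (\<Sum>j<k. g j)"
    using birthday_pos[of k r] assms by (simp add: exp_minus field_simps)
  also have "(\<Sum>j<k. g j) \<le> pair_weight m r / m * (real k * (real k - 1))"
  proof -
    have "(\<Sum>j<k. g j) = (\<Sum>j<k. real j) / r + (\<Sum>j<k. (real j)\<^sup>2) / (2 * (real r)\<^sup>2) + (\<Sum>j<k. real j ^ 3) / real r ^ 3"
      by (simp add: g_def sum.distrib sum_divide_distrib power_divide mult.commute)
    also have "(\<Sum>j<k. real j ^ 3) \<le> (\<Sum>j<k. (real m)\<^sup>2 * real j)"
    proof (rule sum_mono)
      fix j assume "j \<in> {..<k}"
      then have "(real j)\<^sup>2 \<le> (real m)\<^sup>2" using assms by (intro power_mono) auto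
      then have "(real j)\<^sup>2 * real j \<le> (real m)\<^sup>2 * real j" by (intro mult_right_mono) auto
      then show "real j ^ 3 \<le> (real m)\<^sup>2 * real j" by (simp add: power2_eq_square power3_eq_cube)
    qed
    also have "\<dots> = (real m)\<^sup>2 * (real k * (real k - 1) / 2)"
      by (simp add: sum_distrib_left[symmetric] sum_lessThan_real)
    finally have "(\<Sum>j<k. g j) \<le> real k * (real k - 1) / 2 / r
        + real k * (real k - 1) * (2 * real k - 1) / 6 / (2 * (real r)\<^sup>2)
        + (real m)\<^sup>2 * (real k * (real k - 1) / 2) / real r ^ 3"
      unfolding sum_lessThan_real sum_squares_lessThan_real using r0 by (simp add: divide_right_mono)
    also have "\<dots> = (real k * (real k - 1)) * (1 / (2 * real r) + (2 * real k - 1) / (12 * (real r)\<^sup>2) + (real m)\<^sup>2 / real r ^ 3 / 2)"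
      by (simp add: distrib_left mult_ac)
    also have "\<dots> \<le> (real k * (real k - 1)) * (1 / (2 * real r) + (2 * real m - 1) / (12 * (real r)\<^sup>2) + (real m)\<^sup>2 / real r ^ 3)"
    proof (intro mult_left_mono add_mono divide_right_mono)
      show "0 \<le> real k * (real k - 1)" by (cases k) auto
      show "(real m)\<^sup>2 / real r ^ 3 / 2 \<le> (real m)\<^sup>2 / real r ^ 3"
      proof -
        have half: "x / 2 \<le> x" if "0 \<le> x" for x :: real using that by simp
        show ?thesis by (rule half) simp
      qed
    qed (use assms in auto)
    finally show ?thesis using assms by (simp add: pair_weight_def mult.commute)
  qed
  finally show ?thesis by simp
qed

section \<open>Edges fixed by a random permutation\<close>

definition two_cycle_points :: "('a \<Rightarrow> 'a) \<Rightarrow> 'a set" where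
  "two_cycle_points p = {y. p y \<noteq> y \<and> p (p y) = y}"

lemma two_cycle_points_subset: "p permutes B \<Longrightarrow> two_cycle_points p \<subseteq> B"
  by (auto simp: two_cycle_points_def permutes_def)

lemma finite_two_cycle_points: "p permutes B \<Longrightarrow> finite B \<Longrightarrow> finite (two_cycle_points p)"
  using two_cycle_points_subset finite_subset by blast

text \<open>An edge that is fixed as a set has its two ends either fixed or interchanged.\<close>

lemma card_fixed_edges_le:
  assumes "p permutes {1..n}"
  shows "card {e\<in>edges n. p ` e = e} \<le>
    (card {v\<in>{1..n}. p v = v} choose 2) + card (two_cycle_points p) div 2"
proof -
  let ?F = "{v\<in>{1..n}. p v = v}"
  let ?T = "{e\<in>edges n. p ` e = e \<and> e \<subseteq> two_cycle_points p}"
  have pair: "\<exists>u v. e = {u, v} \<and> u \<noteq> v \<and> u \<in> {1..n} \<and> v \<in> {1..n}" if "e \<in> edges n" for e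
    using that unfolding edges_def nsets_def card_2_iff by blast
  have fin: "finite (edges n)" by (simp add: edges_def finite_imp_finite_nsets)
  have sub: "{e\<in>edges n. p ` e = e} \<subseteq> nsets ?F 2 \<union> ?T"
  proof
    fix e assume e: "e \<in> {e\<in>edges n. p ` e = e}"
    then have "e \<in> edges n" by simp
    from pair[OF this] obtain u v where uv: "e = {u, v}" "u \<noteq> v" "u \<in> {1..n}" "v \<in> {1..n}" by auto
    have im: "{p u, p v} = {u, v}" using e uv by simp
    then consider "p u = u" "p v = v" | "p u = v" "p v = u" using uv(2) by (metis doubleton_eq_iff)
    then show "e \<in> nsets ?F 2 \<union> ?T"
    proof cases
      case 1
      then show ?thesis using uv by (auto simp: nsets_def)
    next
      case 2
      then show ?thesis using e uv by (auto simp: two_cycle_points_def)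
    qed
  qed
  have "2 * card ?T \<le> card (two_cycle_points p)"
  proof -
    have disj: "e \<inter> e' = {}" if ee: "e \<in> ?T" "e' \<in> ?T" "e \<noteq> e'" for e e'
    proof (rule ccontr)
      assume "e \<inter> e' \<noteq> {}"
      then obtain u where u: "u \<in> e" "u \<in> e'" by blast
      have "d = {u, p u}" if d: "d \<in> ?T" "u \<in> d" for d
      proof -
        have "d \<in> edges n" using d by simp
        from pair[OF this] obtain x y where xy: "d = {x, y}" "x \<noteq> y" by auto
        have "p u \<in> d" "p u \<noteq> u" using d by (auto simp: two_cycle_points_def)
        then show ?thesis using xy d(2) by auto
      qed
      then show False using ee u by blast
    qed
    have "2 * card ?T = (\<Sum>e\<in>?T. card e)"
      by (simp add: edges_def nsets_def)
    also have "\<dots> = card (\<Union>?T)"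
      using disj fin by (subst card_Union_disjoint) (auto simp: pairwise_def disjnt_def edges_def nsets_def)
    also have "\<dots> \<le> card (two_cycle_points p)"
      using finite_two_cycle_points[OF assms] by (intro card_mono) auto
    finally show ?thesis .
  qed
  then have "card ?T \<le> card (two_cycle_points p) div 2" by linarith
  moreover have "card {e\<in>edges n. p ` e = e} \<le> card (nsets ?F 2) + card ?T"
    using fin by (intro order.trans[OF card_mono[OF _ sub]] card_Un_le) (auto simp: finite_imp_finite_nsets)
  ultimately show ?thesis by (simp add: card_nsets)
qed

text \<open>Composing with \<open>transpose v u\<close> inserts the new point \<open>v\<close> into the cycle of \<open>u\<close>, just before \<open>u\<close>. A cycle of
length two arises in this way only if \<open>u\<close> was a fixed point.\<close>

lemma two_cycle_points_insert:
  assumes p: "p permutes B" and "v \<notin> B"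
  shows "two_cycle_points (Transposition.transpose v u \<circ> p) \<subseteq> two_cycle_points p \<union> (if p u = u then {u, v} else {})"
proof (cases "u = v")
  case True
  then show ?thesis by auto
next
  case False
  have pv: "p v = v" using assms by (auto simp: permutes_def)
  have inj: "p x = p y \<longleftrightarrow> x = y" for x y using permutes_inj[OF p] by (auto simp: inj_def)
  show ?thesis
  proof
    fix y assume "y \<in> two_cycle_points (Transposition.transpose v u \<circ> p)"
    then have y: "Transposition.transpose v u (p y) \<noteq> y" "Transposition.transpose v u (p (Transposition.transpose v u (p y))) = y"
      by (auto simp: two_cycle_points_def)
    show "y \<in> two_cycle_points p \<union> (if p u = u then {u, v} else {})"
    proof (cases "p y = v")
      case True
      then have "y = v" using pv inj by metis
      then have "Transposition.transpose v u (p u) = v" using y pv by simp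
      then have "p u = u" by (metis transpose_apply_first transpose_involutory)
      then show ?thesis using \<open>y = v\<close> by simp
    next
      case pyv: False
      show ?thesis
      proof (cases "p y = u")
        case True
        then have "y = u" using y(2) pv by simp
        then show ?thesis using True by simp
      next
        case False
        then have t: "Transposition.transpose v u (p y) = p y" using pyv by simp
        then have "p (p y) \<noteq> v" using pyv pv inj by metis
        moreover have "p (p y) \<noteq> u"
        proof
          assume "p (p y) = u"
          then have "y = v" using y(2) t by simp
          then show False using pyv pv by simp
        qed
        ultimately show ?thesis using y t by (simp add: two_cycle_points_def)
      qed
    qed
  qed
qed

text \<open>Up to the factor \<open>fact (card B)\<close>, the moment generating function at \<open>l\<close> of the number of cycles of length
two of a uniformly random permutation of \<open>B\<close>.\<close>

definition two_cycle_sum :: "real \<Rightarrow> 'a set \<Rightarrow> real" where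
  "two_cycle_sum l B = (\<Sum>p | p permutes B. exp (l * real (card (two_cycle_points p) div 2)))"

text \<open>A random permutation has on average at most half a cycle of length two, so for small \<open>l\<close> the normalised sum is
close to one. Building up the permutation point by point, the \<open>j\<close>-th point
creates a cycle of length two with probability at most \<open>1 / j\<close>, whence the harmonic number.\<close>

lemma two_cycle_sum_le:
  assumes "finite B" "0 \<le> l"
  shows "two_cycle_sum l B \<le> fact (card B) * exp ((exp l - 1) * harm (card B))"
  using assms(1)
proof (induction "card B" arbitrary: B rule: less_induct)
  case less
  define \<mu> where "\<mu> = exp l - 1"
  define w where "w p = exp (l * real (card (two_cycle_points p) div 2))" for p :: "'a \<Rightarrow> 'a"
  have \<mu>0: "0 \<le> \<mu>" using assms(2) by (simp add: \<mu>_def)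
  show ?case
  proof (cases "B = {}")
    case True
    then show ?thesis by (simp add: two_cycle_sum_def two_cycle_points_def harm_def)
  next
    case False
    then obtain v where "v \<in> B" by blast
    then obtain C where B: "B = insert v C" "v \<notin> C" by (meson mk_disjoint_insert)
    have finC: "finite C" using B less.prems by simp
    define c where "c = card C"
    have cB: "card B = Suc c" using B finC by (simp add: c_def)
    have step: "w (Transposition.transpose v u \<circ> p) \<le> w p + (if u \<in> C \<and> p u = u then \<mu> * w p else 0)"
      if u: "u \<in> insert v C" and p: "p permutes C" for u p
    proof (cases "u = v")
      case True
      then show ?thesis using B(2) by simp
    next
      case False
      then have uC: "u \<in> C" using u by auto
      have finp: "finite (two_cycle_points p)" using finite_two_cycle_points p finC by blast
      show ?thesis
      proof (cases "p u = u")
        case True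
        have "card (two_cycle_points (Transposition.transpose v u \<circ> p)) \<le> card (two_cycle_points p \<union> {u, v})"
          using two_cycle_points_insert[OF p B(2), of u] True finp by (intro card_mono) auto
        also have "\<dots> \<le> card (two_cycle_points p) + 2"
          using card_Un_le[of "two_cycle_points p" "{u, v}"] False by simp
        finally have "card (two_cycle_points (Transposition.transpose v u \<circ> p)) div 2 \<le> card (two_cycle_points p) div 2 + 1"
          by linarith
        then have "l * real (card (two_cycle_points (Transposition.transpose v u \<circ> p)) div 2)
            \<le> l * (real (card (two_cycle_points p) div 2) + 1)"
          using assms(2) by (intro mult_left_mono) linarith+
        then have "w (Transposition.transpose v u \<circ> p) \<le> exp (l * real (card (two_cycle_points p) div 2) + l)"
          unfolding w_def by (simp add: algebra_simps)
        also have "\<dots> = w p + \<mu> * w p" by (simp add: w_def \<mu>_def exp_add algebra_simps)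
        finally show ?thesis using True uC by simp
      next
        case False
        have "card (two_cycle_points (Transposition.transpose v u \<circ> p)) \<le> card (two_cycle_points p)"
          using two_cycle_points_insert[OF p B(2), of u] False finp by (intro card_mono) auto
        then have "card (two_cycle_points (Transposition.transpose v u \<circ> p)) div 2 \<le> card (two_cycle_points p) div 2"
          by (rule div_le_mono)
        then have "l * real (card (two_cycle_points (Transposition.transpose v u \<circ> p)) div 2)
            \<le> l * real (card (two_cycle_points p) div 2)"
          using assms(2) by (intro mult_left_mono) linarith+
        then have "w (Transposition.transpose v u \<circ> p) \<le> w p" unfolding w_def by simp
        then show ?thesis using False by simp
      qed
    qed
    \<comment> \<open>Summing the extra term over permutations with the fixed point \<open>u\<close> gives the same kind of sum on \<open>C - {u}\<close>.\<close>
    have fixset: "{p. p permutes C \<and> p u = u} = {p. p permutes (C - {u})}" if "u \<in> C" for u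
    proof (intro equalityI subsetI CollectI)
      fix p assume "p \<in> {p. p permutes C \<and> p u = u}"
      then show "p permutes (C - {u})" by (auto intro: permutes_superset)
    next
      fix p assume "p \<in> {p. p permutes (C - {u})}"
      then show "p permutes C \<and> p u = u" by (auto intro: permutes_subset simp: permutes_def)
    qed
    have finP: "finite {p. p permutes C}" using finC by (rule finite_permutations)
    have "two_cycle_sum l B = (\<Sum>u\<in>insert v C. \<Sum>p | p permutes C. w (Transposition.transpose v u \<circ> p))"
      unfolding two_cycle_sum_def B(1) w_def[symmetric]
      by (rule sum_over_permutations_insert[OF finC B(2)])
    also have "\<dots> \<le> (\<Sum>u\<in>insert v C. \<Sum>p | p permutes C. w p + (if u \<in> C \<and> p u = u then \<mu> * w p else 0))"
      by (intro sum_mono step) auto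
    also have "\<dots> = (\<Sum>u\<in>insert v C. two_cycle_sum l C)
        + (\<Sum>u\<in>insert v C. \<Sum>p | p permutes C. if u \<in> C \<and> p u = u then \<mu> * w p else 0)"
      unfolding sum.distrib by (simp only: two_cycle_sum_def w_def[symmetric])
    also have "(\<Sum>u\<in>insert v C. \<Sum>p | p permutes C. if u \<in> C \<and> p u = u then \<mu> * w p else 0)
        = (\<Sum>u\<in>C. \<Sum>p | p permutes C. if p u = u then \<mu> * w p else 0)"
      using B(2) finC by simp
    also have "\<dots> = (\<Sum>u\<in>C. \<mu> * two_cycle_sum l (C - {u}))"
    proof (intro sum.cong refl)
      fix u assume u: "u \<in> C"
      have "(\<Sum>p | p permutes C. if p u = u then \<mu> * w p else 0) = (\<Sum>p\<in>{p. p permutes C \<and> p u = u}. \<mu> * w p)"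
        using finP by (simp add: sum.inter_filter[symmetric])
      then show "(\<Sum>p | p permutes C. if p u = u then \<mu> * w p else 0) = \<mu> * two_cycle_sum l (C - {u})"
        unfolding fixset[OF u] two_cycle_sum_def w_def by (simp add: sum_distrib_left)
    qed
    also have "(\<Sum>u\<in>insert v C. two_cycle_sum l C) = real (Suc c) * two_cycle_sum l C"
      using finC B(2) by (simp add: c_def)
    also have "two_cycle_sum l C \<le> fact c * exp (\<mu> * harm c)"
      using less.hyps[of C] finC cB by (simp add: c_def \<mu>_def)
    also have "(\<Sum>u\<in>C. \<mu> * two_cycle_sum l (C - {u})) \<le> (\<Sum>u\<in>C. \<mu> * (fact (c - 1) * exp (\<mu> * harm c)))"
    proof (intro sum_mono mult_left_mono \<mu>0)
      fix u assume u: "u \<in> C"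
      then have cu: "card (C - {u}) = c - 1" using finC by (simp add: c_def)
      have "two_cycle_sum l (C - {u}) \<le> fact (c - 1) * exp (\<mu> * harm (c - 1))"
        using less.hyps[of "C - {u}"] finC cB cu by (simp add: \<mu>_def)
      also have "\<dots> \<le> fact (c - 1) * exp (\<mu> * harm c)"
        using \<mu>0 by (intro mult_left_mono) (auto intro!: mult_left_mono harm_mono)
      finally show "two_cycle_sum l (C - {u}) \<le> fact (c - 1) * exp (\<mu> * harm c)" .
    qed
    also have "\<dots> = \<mu> * (real c * fact (c - 1)) * exp (\<mu> * harm c)" by (simp add: c_def)
    also have "\<dots> \<le> \<mu> * fact c * exp (\<mu> * harm c)"
    proof -
      have "real c * fact (c - 1) \<le> fact c" by (cases c) auto
      then show ?thesis using \<mu>0 by (intro mult_right_mono mult_left_mono) auto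
    qed
    also have "real (Suc c) * (fact c * exp (\<mu> * harm c)) + \<mu> * fact c * exp (\<mu> * harm c)
        = fact (Suc c) * exp (\<mu> * harm c) * (1 + \<mu> / real (Suc c))"
      by (simp add: field_simps)
    also have "\<dots> \<le> fact (Suc c) * exp (\<mu> * harm c) * exp (\<mu> / real (Suc c))"
      by (intro mult_left_mono exp_ge_add_one_self) auto
    also have "\<dots> = fact (Suc c) * exp (\<mu> * harm (Suc c))"
      by (simp add: harm_Suc exp_add[symmetric] algebra_simps divide_inverse)
    finally show ?thesis by (simp add: cB \<mu>_def)
  qed
qed

definition fixed_edge_sum :: "nat \<Rightarrow> real \<Rightarrow> real" where
  "fixed_edge_sum n l = (\<Sum>p | p permutes {1..n}. exp (l * real (card {e\<in>edges n. p ` e = e})))"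

lemma sum_Pow_card:
  fixes h :: "nat \<Rightarrow> real"
  assumes "finite A"
  shows "(\<Sum>B\<in>Pow A. h (card B)) = (\<Sum>k\<le>card A. real (card A choose k) * h k)"
proof -
  have "(\<Sum>B\<in>Pow A. h (card B)) = (\<Sum>k\<le>card A. \<Sum>B\<in>{B\<in>Pow A. card B = k}. h (card B))"
    using assms by (intro sum.group[symmetric]) (auto intro: card_mono)
  also have "\<dots> = (\<Sum>k\<le>card A. real (card A choose k) * h k)"
    using assms by (intro sum.cong refl) (simp add: n_subsets Pow_def)
  finally show ?thesis .
qed

text \<open>Each permutation is grouped by its set \<open>A\<close> of fixed points. There are \<open>n choose k\<close> sets of size \<open>k\<close>, and at
most \<open>fact (n - k)\<close> permutations for each, which leaves \<open>1 / fact k\<close> after normalisation. Subtracting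
one from the weight of the edges inside \<open>A\<close> separates the main term one from a sum that will be shown to
vanish in the limit.\<close>

lemma fixed_edge_sum_le:
  assumes "0 \<le> l"
  shows "fixed_edge_sum n l \<le> fact n * exp ((exp l - 1) * harm n) *
    (1 + (\<Sum>k\<le>n. (exp (l * real (k choose 2)) - 1) / fact k))"
proof -
  define H where "H = exp ((exp l - 1) * (harm n :: real))"
  define w where "w p = exp (l * real (card (two_cycle_points p) div 2))" for p :: "nat \<Rightarrow> nat"
  define g where "g k = exp (l * real (k choose 2)) - 1" for k
  define fp where "fp p = {v\<in>{1..n}. p v = v}" for p :: "nat \<Rightarrow> nat"
  let ?P = "{p. p permutes {1..n}}"
  have g0: "0 \<le> g k" for k using assms by (simp add: g_def)
  have w0: "0 \<le> w p" for p by (simp add: w_def)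
  have fp_sub: "fp p \<in> Pow {1..n}" for p by (auto simp: fp_def)
  have finP: "finite ?P" by (rule finite_permutations) simp
  have W: "two_cycle_sum l ({1..n} - A) \<le> fact (n - card A) * H" if A: "A \<subseteq> {1..n}" for A
  proof -
    have c: "card ({1..n} - A) = n - card A" using A by (subst card_Diff_subset) (auto intro: finite_subset)
    have "two_cycle_sum l ({1..n} - A) \<le> fact (n - card A) * exp ((exp l - 1) * harm (n - card A))"
      using two_cycle_sum_le[of "{1..n} - A" l] assms c by simp
    also have "\<dots> \<le> fact (n - card A) * H"
      unfolding H_def using assms by (intro mult_left_mono) (auto intro!: mult_left_mono harm_mono)
    finally show ?thesis .
  qed
  have "fixed_edge_sum n l \<le> (\<Sum>p\<in>?P. w p + g (card (fp p)) * w p)"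
    unfolding fixed_edge_sum_def
  proof (rule sum_mono)
    fix p assume "p \<in> ?P"
    then have "real (card {e\<in>edges n. p ` e = e})
        \<le> real ((card (fp p) choose 2) + card (two_cycle_points p) div 2)"
      unfolding fp_def of_nat_le_iff by (intro card_fixed_edges_le) auto
    then have "l * real (card {e\<in>edges n. p ` e = e})
        \<le> l * real ((card (fp p) choose 2) + card (two_cycle_points p) div 2)"
      using assms by (rule mult_left_mono)
    then have "exp (l * real (card {e\<in>edges n. p ` e = e}))
        \<le> exp (l * real (card (fp p) choose 2) + l * real (card (two_cycle_points p) div 2))"
      by (simp add: distrib_left)
    also have "\<dots> = w p + g (card (fp p)) * w p" by (simp add: w_def g_def exp_add algebra_simps)
    finally show "exp (l * real (card {e\<in>edges n. p ` e = e})) \<le> w p + g (card (fp p)) * w p" .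
  qed
  also have "\<dots> = two_cycle_sum l {1..n} + (\<Sum>p\<in>?P. g (card (fp p)) * w p)"
    by (simp add: sum.distrib two_cycle_sum_def w_def)
  also have "(\<Sum>p\<in>?P. g (card (fp p)) * w p) =
      (\<Sum>p\<in>?P. \<Sum>A\<in>Pow {1..n}. if A = fp p then g (card A) * w p else 0)"
    using fp_sub by (intro sum.cong refl) (simp add: sum.delta)
  also have "\<dots> = (\<Sum>A\<in>Pow {1..n}. \<Sum>p\<in>?P. if A = fp p then g (card A) * w p else 0)"
    by (rule sum.swap)
  also have "\<dots> \<le> (\<Sum>A\<in>Pow {1..n}. g (card A) * two_cycle_sum l ({1..n} - A))"
  proof (rule sum_mono)
    fix A assume A: "A \<in> Pow {1..n}"
    have "(\<Sum>p\<in>?P. if A = fp p then g (card A) * w p else 0) = (\<Sum>p\<in>{p\<in>?P. A = fp p}. g (card A) * w p)"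
      using finP by (rule sum.inter_filter[symmetric])
    also have "\<dots> \<le> (\<Sum>p\<in>{p. p permutes ({1..n} - A)}. g (card A) * w p)"
    proof (rule sum_mono2)
      show "finite {p. p permutes ({1..n} - A)}" by (rule finite_permutations) simp
      show "{p\<in>?P. A = fp p} \<subseteq> {p. p permutes ({1..n} - A)}"
        by (auto simp: fp_def intro: permutes_superset)
    qed (use g0 w0 in auto)
    finally show "(\<Sum>p\<in>?P. if A = fp p then g (card A) * w p else 0) \<le> g (card A) * two_cycle_sum l ({1..n} - A)"
      by (simp add: two_cycle_sum_def w_def sum_distrib_left)
  qed
  also have "\<dots> \<le> (\<Sum>A\<in>Pow {1..n}. g (card A) * (fact (n - card A) * H))"
    using W g0 by (intro sum_mono mult_left_mono) auto
  also have "\<dots> = (\<Sum>k\<le>n. real (n choose k) * (g k * (fact (n - k) * H)))"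
    using sum_Pow_card[of "{1..n}" "\<lambda>k. g k * (fact (n - k) * H)"] by simp
  also have "\<dots> = (\<Sum>k\<le>n. fact n * H * (g k / fact k))"
    by (intro sum.cong refl) (simp add: binomial_fact)
  also have "\<dots> = fact n * H * (\<Sum>k\<le>n. g k / fact k)" by (simp add: sum_distrib_left)
  also have "two_cycle_sum l {1..n} \<le> fact n * H" using W[of "{}"] by simp
  finally show ?thesis by (simp add: H_def g_def distrib_left)
qed

section \<open>Asymptotics of the sum over fixed edges\<close>

lemma ln_fact_le: "n \<ge> 1 \<Longrightarrow> ln (fact n) \<le> (real n - 1) * ln (real n)"
proof (induction n rule: nat_induct_at_least)
  case (Suc n)
  have "ln (fact (Suc n)) = ln (real (Suc n)) + ln (fact n :: real)"
    by (simp add: ln_mult)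
  also have "\<dots> \<le> ln (real (Suc n)) + (real n - 1) * ln (real (Suc n))"
  proof (intro add_left_mono order.trans[OF Suc.IH] mult_left_mono)
    show "ln (real n) \<le> ln (real (Suc n))" using Suc.hyps by (subst ln_le_cancel_iff) auto
  qed (use Suc.hyps in auto)
  also have "\<dots> = (real (Suc n) - 1) * ln (real (Suc n))" by (simp add: algebra_simps)
  finally show ?case .
qed simp

lemma ln_fact_ge: "real n * ln (real n) - real n \<le> ln (fact n)"
proof (induction n)
  case (Suc n)
  show ?case
  proof (cases "n = 0")
    case False
    have "ln (real (Suc n)) - ln (real n) = ln (1 + 1 / real n)"
    proof -
      have "real (Suc n) = real n * (1 + 1 / real n)" using False by (simp add: field_simps)
      moreover have "ln (real n * (1 + 1 / real n)) = ln (real n) + ln (1 + 1 / real n)"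
        using False by (intro ln_mult_pos) (auto intro: add_pos_pos)
      ultimately show ?thesis by simp
    qed
    also have "\<dots> \<le> 1 / real n" by (rule ln_add_one_self_le_self) simp
    finally have "real n * (ln (real (Suc n)) - ln (real n)) \<le> real n * (1 / real n)"
      by (intro mult_left_mono) auto
    then have "real n * ln (real (Suc n)) \<le> real n * ln (real n) + 1"
      using False by (simp add: algebra_simps)
    then have "real (Suc n) * ln (real (Suc n)) - real (Suc n) \<le> ln (real (Suc n)) + ln (fact n)"
      using Suc.IH by (simp add: algebra_simps)
    also have "\<dots> = ln (fact (Suc n))" by (simp add: ln_mult)
    finally show ?thesis .
  qed simp
qed simp

lemma ln_fact_diff_le: "k \<le> n \<Longrightarrow> ln (fact n) - real (n - k) * ln (real n) \<le> ln (fact k)"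
proof (induction k rule: inc_induct)
  case (step k)
  have "ln (fact (Suc k)) = ln (real (Suc k)) + ln (fact k :: real)"
    by (simp add: ln_mult)
  moreover have "ln (real (Suc k)) \<le> ln (real n)"
    using step.hyps by (subst ln_le_cancel_iff) auto
  moreover have "real (n - k) * ln (real n) = real (n - Suc k) * ln (real n) + ln (real n)"
  proof -
    have "real (n - k) = real (n - Suc k) + 1" using step.hyps by simp
    then show ?thesis by (simp only: distrib_right mult_1)
  qed
  ultimately show ?case using step.IH by linarith
qed simp

lemma real_choose_2: "real (n choose 2) = real n * (real n - 1) / 2"
  by (induction n) (auto simp: numeral_2_eq_2 field_simps)

lemma harm_le: "n \<ge> 1 \<Longrightarrow> harm n \<le> ln (real n) + (1 :: real)"
  using euler_mascheroni_sequence_decreasing[of 1 n] by (simp add: harm_def)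

text \<open>A dominating sequence for permutations with at most \<open>n / 2\<close> fixed points.\<close>

definition low_fix_term :: "nat \<Rightarrow> real" where
  "low_fix_term k = (real k)\<^sup>2 * exp (real k * ln (2 * real k) / 2) / fact k"

text \<open>Up to factors that grow exponentially, \<open>low_fix_term k\<close> is \<open>k powr (k / 2) / k powr k\<close>.\<close>

lemma summable_low_fix_term: "summable low_fix_term"
proof (rule summable_comparison_test_ev)
  have "eventually (\<lambda>k. (real k)\<^sup>2 * exp (real k * ln (2 * real k) / 2 - (real k * ln (real k) - real k))
      \<le> (1 / 2) ^ k) at_top"
    by real_asymp
  then show "eventually (\<lambda>k. norm (low_fix_term k) \<le> (1 / 2) ^ k) sequentially"
  proof eventually_elim
    case (elim k)
    have "exp (real k * ln (real k) - real k) \<le> exp (ln (fact k))"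
      using ln_fact_ge[of k] by (subst exp_le_cancel_iff)
    then have f: "exp (real k * ln (real k) - real k) \<le> fact k" by simp
    have "norm (low_fix_term k) = (real k)\<^sup>2 * exp (real k * ln (2 * real k) / 2) / fact k"
      by (simp add: low_fix_term_def)
    also have "\<dots> \<le> (real k)\<^sup>2 * exp (real k * ln (2 * real k) / 2) / exp (real k * ln (real k) - real k)"
      using f by (intro divide_left_mono) auto
    also have "\<dots> = (real k)\<^sup>2 * exp (real k * ln (2 * real k) / 2 - (real k * ln (real k) - real k))"
      by (simp add: exp_diff)
    finally show ?case using elim by linarith
  qed
  show "summable (\<lambda>k. (1 / 2 :: real) ^ k)" by (rule summable_geometric) simp
qed

text \<open>As \<open>ln x / x\<close> is decreasing for \<open>x \<ge> exp 1\<close>, the hypotheses \<open>l \<le> 2 * ln n / n\<close> and \<open>2 * k \<le> n\<close> give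
\<open>l \<le> 2 * ln (2 * k) / (2 * k)\<close>, a bound free of \<open>n\<close>. The factor \<open>l\<close> is kept since it tends to zero.\<close>

lemma low_fix_bound:
  assumes "n \<ge> 1" "0 \<le> l" "l \<le> 2 * ln (real n) / real n" "2 * k \<le> n"
  shows "(exp (l * real (k choose 2)) - 1) / fact k \<le> l * low_fix_term k"
proof (cases "k \<le> 1")
  case True
  then consider "k = 0" | "k = 1" by linarith
  then show ?thesis using assms(2) by cases (simp_all add: low_fix_term_def real_choose_2)
next
  case False
  then have k: "2 \<le> k" by simp
  define x where "x = l * real (k choose 2)"
  have x0: "0 \<le> x" using assms(2) by (simp add: x_def)
  have c: "real (k choose 2) \<le> (real k)\<^sup>2 / 2" "real (k choose 2) \<le> (real k)\<^sup>2"
    using k by (simp_all add: real_choose_2 power2_eq_square field_simps)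
  have e: "exp (1::real) \<le> 2 * real k" using k exp_le by linarith
  have "x \<le> (2 * ln (real n) / real n) * ((real k)\<^sup>2 / 2)"
    unfolding x_def using assms(1,3) c(1) by (intro mult_mono) auto
  also have "\<dots> = (real k)\<^sup>2 * (ln (real n) / real n)" by simp
  also have "\<dots> \<le> (real k)\<^sup>2 * (ln (2 * real k) / (2 * real k))"
    using e assms(4) by (intro mult_left_mono ln_x_over_x_mono) auto
  also have "\<dots> = real k * ln (2 * real k) / 2"
    using k by (simp add: power2_eq_square)
  finally have x: "x \<le> real k * ln (2 * real k) / 2" .
  have "1 - x \<le> exp (- x)" using exp_ge_add_one_self[of "- x"] by simp
  then have "(1 - x) * exp x \<le> exp (- x) * exp x" by (rule mult_right_mono) simp
  then have "exp x - 1 \<le> x * exp x" by (simp add: exp_minus algebra_simps)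
  also have "\<dots> \<le> (l * (real k)\<^sup>2) * exp (real k * ln (2 * real k) / 2)"
    using x x0 c(2) assms(2) by (intro mult_mono) (auto simp: x_def intro: mult_left_mono)
  finally have "(exp x - 1) / fact k \<le> (l * (real k)\<^sup>2) * exp (real k * ln (2 * real k) / 2) / fact k"
    by (rule divide_right_mono) simp
  then show ?thesis by (simp add: x_def low_fix_term_def)
qed

text \<open>The identity alone contributes at most \<open>exp (- w)\<close>, by the assumption on \<open>l\<close>. With \<open>h = n - k\<close> points
moved, at least \<open>3 / 2 * h / n\<close> of all edges are lost, which costs a factor of about \<open>n powr (- 3 / 2 * h)\<close>, while the
number of permutations grows only by \<open>n powr h\<close>.\<close>

lemma high_fix_bound:
  assumes "n \<ge> 2" "0 \<le> l" "0 \<le> w" "l * real (n choose 2) \<le> ln (fact n) - w" "k \<le> n" "n < 2 * k"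
    and big: "ln 2 + 3 / 2 \<le> ln (real n) / 2"
  shows "(exp (l * real (k choose 2)) - 1) / fact k \<le> exp (- w / 4) * (1 / 2) ^ (n - k)"
proof -
  define L where "L = ln (fact n :: real)"
  define N K where "N = real n" and "K = real k"
  define h where "h = real (n - k)"
  define \<rho> where "\<rho> = K * (K - 1) / (N * (N - 1))"
  have h: "h = N - K" "0 \<le> h" using assms(5) by (simp_all add: h_def N_def K_def)
  have N: "N \<ge> 2" using assms(1) by (simp add: N_def)
  have K: "2 * K \<ge> N + 1" using assms(6) unfolding N_def K_def by linarith
  have N1: "0 < N * (N - 1)" using N by simp
  have ch: "real (n choose 2) = N * (N - 1) / 2" "real (k choose 2) = K * (K - 1) / 2"
    by (simp_all add: real_choose_2 N_def K_def)
  have "l * real (k choose 2) = (l * real (n choose 2)) * \<rho>"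
    unfolding ch \<rho>_def using N by (simp add: field_simps)
  also have "\<dots> \<le> (L - w) * \<rho>"
    using assms(4) K N by (intro mult_right_mono) (auto simp: L_def \<rho>_def)
  finally have le: "l * real (k choose 2) \<le> L - L * (1 - \<rho>) - w * \<rho>" by (simp add: algebra_simps)
  have "(N + 1) * (N - 1) \<le> (2 * K) * (2 * (K - 1))"
    using K N by (intro mult_mono) auto
  then have "1 / 4 * (N * (N - 1)) \<le> K * (K - 1)"
  proof -
    have "(N + 1) * (N - 1) = N * (N - 1) + (N - 1)" "2 * K * (2 * (K - 1)) = 4 * (K * (K - 1))"
      by (simp_all add: algebra_simps)
    then show ?thesis using \<open>(N + 1) * (N - 1) \<le> _\<close> N by linarith
  qed
  then have "1 / 4 \<le> \<rho>"
    unfolding \<rho>_def using N1 by (subst pos_le_divide_eq)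
  then have w: "w * (1 / 4) \<le> w * \<rho>" using assms(3) by (rule mult_left_mono)
  have "1 - \<rho> = h * (N + K - 1) / (N * (N - 1))"
    unfolding \<rho>_def h using N by (simp add: field_simps)
  moreover have "h * (3 / 2 * (N - 1)) / (N * (N - 1)) \<le> h * (N + K - 1) / (N * (N - 1))"
    using h K N1 by (intro divide_right_mono mult_left_mono) auto
  moreover have "h * (3 / 2 * (N - 1)) / (N * (N - 1)) = 3 / 2 * h / N"
    using N by (simp add: field_simps)
  ultimately have rho: "3 / 2 * h / N \<le> 1 - \<rho>" by simp
  have L0: "0 \<le> L" by (simp add: L_def)
  have "(N * ln N - N) * (3 / 2 * h / N) \<le> L * (3 / 2 * h / N)"
    using ln_fact_ge[of n] h N by (intro mult_right_mono) (auto simp: L_def N_def)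
  also have "\<dots> \<le> L * (1 - \<rho>)" using rho L0 by (rule mult_left_mono)
  also have "(N * ln N - N) * (3 / 2 * h / N) = 3 / 2 * h * (ln N - 1)"
    using N by (simp add: field_simps)
  finally have L\<rho>: "3 / 2 * h * (ln N - 1) \<le> L * (1 - \<rho>)" .
  have lk: "L - h * ln N \<le> ln (fact k)"
    using ln_fact_diff_le[OF assms(5)] by (simp add: L_def h_def N_def)
  have "h * (ln 2 + 3 / 2) \<le> h * (ln N / 2)" using big h by (intro mult_left_mono) (auto simp: N_def)
  then have hh: "h * ln N - 3 / 2 * h * (ln N - 1) \<le> - (h * ln 2)" by (simp add: algebra_simps)
  have "(exp (l * real (k choose 2)) - 1) / fact k \<le> exp (l * real (k choose 2)) / exp (ln (fact k))"
    by (simp add: divide_right_mono)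
  also have "\<dots> = exp (l * real (k choose 2) - ln (fact k))" by (simp add: exp_diff)
  also have "\<dots> \<le> exp (- w / 4 + - (h * ln 2))"
    using le w L\<rho> lk hh by (subst exp_le_cancel_iff) linarith
  also have "\<dots> = exp (- w / 4) * exp (- ln 2) ^ (n - k)"
    unfolding exp_add by (simp add: h_def exp_of_nat_mult[symmetric])
  also have "exp (- ln 2) = (1 / 2 :: real)" by (simp add: exp_minus)
  finally show ?thesis .
qed

lemma sum_half_powers_le: "(\<Sum>k\<le>n. (1 / 2 :: real) ^ (n - k)) \<le> 2"
proof (induction n)
  case (Suc n)
  have "(\<Sum>k\<le>n. (1 / 2 :: real) ^ (Suc n - k)) = (\<Sum>k\<le>n. 1 / 2 * (1 / 2) ^ (n - k))"
    by (intro sum.cong refl) (simp add: Suc_diff_le)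
  also have "\<dots> = 1 / 2 * (\<Sum>k\<le>n. (1 / 2) ^ (n - k))" by (simp add: sum_distrib_left)
  finally show ?case using Suc.IH by simp
qed simp

text \<open>The mean of \<open>exp (l * F)\<close>, with \<open>F\<close> the number of edges that a random permutation fixes, is asymptotically at
most one, provided that the contribution of the identity alone vanishes, which \<open>w\<close> ensures. Apart from the factor for
cycles of length two, which tends to one, the excess over one is at most a multiple of \<open>ln n / n\<close> from the permutations
with at most \<open>n / 2\<close> fixed points, and \<open>2 * exp (- w n / 4)\<close> from the others.\<close>

lemma fixed_edge_sum_asymp:
  fixes l w :: "nat \<Rightarrow> real"
  assumes w: "filterlim w at_top sequentially"
    and l: "\<forall>\<^sub>F n in sequentially. 0 \<le> l n \<and> l n * real (n choose 2) \<le> ln (fact n) - w n"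
  shows "\<exists>u. u \<longlonglongrightarrow> 1 \<and> (\<forall>\<^sub>F n in sequentially. fixed_edge_sum n (l n) \<le> fact n * u n)"
proof -
  define S where "S = (\<Sum>k. low_fix_term k)"
  define b where "b n = 2 * ln (real n) / real n" for n :: nat
  define u where "u n = exp ((exp (b n) - 1) * (ln (real n) + 1)) * (1 + (b n * S + 2 * exp (- w n / 4)))" for n
  have low0: "0 \<le> low_fix_term k" for k by (simp add: low_fix_term_def)
  have "(\<lambda>n. (exp (b n) - 1) * (ln (real n) + 1)) \<longlonglongrightarrow> 0"
    unfolding b_def by real_asymp
  moreover have "b \<longlonglongrightarrow> 0" unfolding b_def by real_asymp
  moreover have "(\<lambda>n. exp (- w n / 4)) \<longlonglongrightarrow> 0"
  proof -
    have "filterlim (\<lambda>n. w n * (1 / 4)) at_top sequentially"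
      using w by (intro filterlim_at_top_mult_tendsto_pos[OF tendsto_const]) auto
    then have "filterlim (\<lambda>n. - (w n / 4)) at_bot sequentially"
      by (simp add: filterlim_uminus_at_top)
    then show ?thesis by (intro filterlim_compose[OF exp_at_bot]) simp
  qed
  ultimately have "u \<longlonglongrightarrow> exp 0 * (1 + (0 * S + 2 * 0))"
    unfolding u_def by (intro tendsto_intros)
  then have u: "u \<longlonglongrightarrow> 1" by simp
  have w0: "\<forall>\<^sub>F n in sequentially. 0 \<le> w n"
    using w by (simp add: filterlim_at_top)
  have big: "\<forall>\<^sub>F n in sequentially. ln 2 + 3 / 2 \<le> ln (real n) / 2" by real_asymp
  have "\<forall>\<^sub>F n in sequentially. fixed_edge_sum n (l n) \<le> fact n * u n"
    using l w0 big eventually_ge_at_top[of 2]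
  proof eventually_elim
    case (elim n)
    have "l n * real (n choose 2) \<le> (real n - 1) * ln (real n)"
      using elim ln_fact_le[of n] by linarith
    moreover have "l n * real (n choose 2) = (real n - 1) * (l n * real n / 2)"
      by (simp add: real_choose_2)
    ultimately have "(real n - 1) * (l n * real n / 2) \<le> (real n - 1) * ln (real n)" by simp
    then have "l n * real n / 2 \<le> ln (real n)" by (rule mult_left_le_imp_le) (use elim in auto)
    then have "l n * real n \<le> 2 * ln (real n)" by linarith
    then have lb: "l n \<le> b n" unfolding b_def using elim by (subst pos_le_divide_eq) auto
    have termwise: "(exp (l n * real (k choose 2)) - 1) / fact k
        \<le> l n * low_fix_term k + exp (- w n / 4) * (1 / 2) ^ (n - k)" if "k \<le> n" for k
    proof (cases "2 * k \<le> n")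
      case True
      then show ?thesis using low_fix_bound[of n "l n" k] lb elim by (simp add: b_def add_increasing2)
    next
      case False
      then show ?thesis using high_fix_bound[of n "l n" "w n" k] that elim low0[of k]
        by (simp add: add_increasing)
    qed
    have "(\<Sum>k\<le>n. (exp (l n * real (k choose 2)) - 1) / fact k)
        \<le> (\<Sum>k\<le>n. l n * low_fix_term k + exp (- w n / 4) * (1 / 2) ^ (n - k))"
      using termwise by (intro sum_mono) auto
    also have "\<dots> = l n * (\<Sum>k\<le>n. low_fix_term k) + exp (- w n / 4) * (\<Sum>k\<le>n. (1 / 2) ^ (n - k))"
      by (simp add: sum.distrib sum_distrib_left)
    also have "\<dots> \<le> b n * S + exp (- w n / 4) * 2"
    proof (intro add_mono mult_mono mult_left_mono sum_half_powers_le lb)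
      show "(\<Sum>k\<le>n. low_fix_term k) \<le> S"
        unfolding S_def using low0 by (intro sum_le_suminf summable_low_fix_term) auto
      show "0 \<le> b n" using lb elim by linarith
    qed (use low0 in \<open>auto intro: sum_nonneg\<close>)
    finally have s: "(\<Sum>k\<le>n. (exp (l n * real (k choose 2)) - 1) / fact k) \<le> b n * S + 2 * exp (- w n / 4)"
      by simp
    have "(exp (l n) - 1) * harm n \<le> (exp (b n) - 1) * (ln (real n) + 1)"
      using lb elim harm_le[of n] by (intro mult_mono) (auto simp: harm_nonneg)
    then have e: "exp ((exp (l n) - 1) * harm n) \<le> exp ((exp (b n) - 1) * (ln (real n) + 1))" by simp
    have "fixed_edge_sum n (l n) \<le> fact n * (exp ((exp (l n) - 1) * harm n) *
        (1 + (\<Sum>k\<le>n. (exp (l n * real (k choose 2)) - 1) / fact k)))"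
      using fixed_edge_sum_le[of "l n" n] elim by (simp add: mult.assoc)
    also have "\<dots> \<le> fact n * u n"
      unfolding u_def using e s elim
      by (intro mult_left_mono mult_mono add_left_mono) (auto intro!: add_nonneg_nonneg sum_nonneg)
    finally show ?case .
  qed
  then show ?thesis using u by blast
qed

section \<open>Rainbow stackings as proper colourings\<close>

text \<open>A colour is drawn for each pair of a colouring \<open>i\<close> and an edge \<open>e\<close>.\<close>

definition items :: "nat \<Rightarrow> nat \<Rightarrow> (nat \<times> nat set) set" where
  "items m n = {1..m} \<times> edges n"

text \<open>The edge on which the stacking \<open>\<sigma>\<close> places a colour. A stacking is rainbow if colours in the same
position are distinct.\<close>

definition position :: "(nat \<Rightarrow> nat \<Rightarrow> nat) \<Rightarrow> nat \<times> nat set \<Rightarrow> nat set" where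
  "position \<sigma> x = \<sigma> (fst x) ` snd x"

text \<open>Tuples of permutations are made extensional so that there are finitely many of them.\<close>

definition stackings :: "nat \<Rightarrow> nat \<Rightarrow> (nat \<Rightarrow> nat \<Rightarrow> nat) set" where
  "stackings m n = {1..m} \<rightarrow>\<^sub>E {p. p permutes {1..n}}"

abbreviation rainbow_set :: "nat \<Rightarrow> nat \<Rightarrow> nat \<Rightarrow> (nat \<Rightarrow> nat \<Rightarrow> nat) \<Rightarrow> (nat \<times> nat set \<Rightarrow> nat) set" where
  "rainbow_set m n r \<sigma> \<equiv> proper_colourings (position \<sigma>) (position \<sigma>) r (items m n)"

lemma finite_edges [simp]: "finite (edges n)" and card_edges: "card (edges n) = n choose 2"
  by (simp_all add: edges_def finite_imp_finite_nsets card_nsets)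

lemma finite_items [simp]: "finite (items m n)" and card_items: "card (items m n) = m * (n choose 2)"
  by (simp_all add: items_def card_edges card_cartesian_product)

lemma finite_stackings [simp]: "finite (stackings m n)"
  by (simp add: stackings_def finite_PiE finite_permutations)

lemma card_stackings: "card (stackings m n) = fact n ^ m"
  by (simp add: stackings_def card_PiE card_permutations)

lemma permutes_image_edges: "p permutes {1..n} \<Longrightarrow> e \<in> edges n \<Longrightarrow> p ` e \<in> edges n"
  by (auto simp: edges_def nsets_def card_image permutes_inj_on permutes_in_image finite_imageI
      dest: permutes_in_image[THEN iffD2])

lemma permutes_image_inv: "p permutes S \<Longrightarrow> p ` (inv p ` e) = e" "p permutes S \<Longrightarrow> inv p ` (p ` e) = e"
  by (simp_all add: image_comp permutes_inv_o)

lemma permutes_image_eq_iff: "p permutes S \<Longrightarrow> p ` e = f \<longleftrightarrow> e = inv p ` f"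
  using permutes_image_inv by metis

lemma stackingsD: "\<sigma> \<in> stackings m n \<Longrightarrow> i \<in> {1..m} \<Longrightarrow> \<sigma> i permutes {1..n}"
  by (auto simp: stackings_def)

lemma position_items: "\<sigma> \<in> stackings m n \<Longrightarrow> position \<sigma> ` items m n \<subseteq> edges n"
  unfolding position_def items_def
  by (auto simp del: One_nat_def intro!: permutes_image_edges elim: stackingsD)

text \<open>Every edge receives exactly one colour from each of the \<open>m\<close> colourings.\<close>

lemma position_class:
  assumes "\<sigma> \<in> stackings m n" "e \<in> edges n"
  shows "{x\<in>items m n. position \<sigma> x = e} = (\<lambda>i. (i, inv (\<sigma> i) ` e)) ` {1..m}"
proof (intro equalityI subsetI)
  fix x assume "x \<in> {x\<in>items m n. position \<sigma> x = e}"
  then have x: "fst x \<in> {1..m}" "\<sigma> (fst x) ` snd x = e" by (auto simp: items_def position_def)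
  then have "snd x = inv (\<sigma> (fst x)) ` e"
    using stackingsD[OF assms(1) x(1)] by (simp add: permutes_image_eq_iff)
  then show "x \<in> (\<lambda>i. (i, inv (\<sigma> i) ` e)) ` {1..m}"
    using x(1) by (intro image_eqI[of _ _ "fst x"]) (auto simp: prod_eq_iff)
next
  fix x assume "x \<in> (\<lambda>i. (i, inv (\<sigma> i) ` e)) ` {1..m}"
  then obtain i where i: "i \<in> {1..m}" "x = (i, inv (\<sigma> i) ` e)" by blast
  note p = stackingsD[OF assms(1) i(1)]
  show "x \<in> {x\<in>items m n. position \<sigma> x = e}"
    using i permutes_image_inv(1)[OF p] permutes_image_edges[OF permutes_inv[OF p] assms(2)]
    by (simp add: items_def position_def)
qed

lemma card_position_class:
  assumes "\<sigma> \<in> stackings m n" "e \<in> edges n"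
  shows "card {x\<in>items m n. position \<sigma> x = e} = m"
  unfolding position_class[OF assms] by (subst card_image) (auto simp: inj_on_def)

lemma card_rainbow_set:
  assumes "\<sigma> \<in> stackings m n" "r > 0"
  shows "real (card (rainbow_set m n r \<sigma>)) = real r ^ card (items m n) * birthday r m ^ (n choose 2)"
proof -
  have "(\<Prod>e\<in>edges n. birthday r (card {x\<in>items m n. position \<sigma> x = e})) = (\<Prod>e\<in>edges n. birthday r m)"
    using card_position_class[OF assms(1)] by simp
  then show ?thesis
    using card_proper_colourings_single[OF _ _ position_items[OF assms(1)] assms(2)] by (simp add: card_edges)
qed

text \<open>Colourings have default values outside of the relevant indices, whereas proper colourings are extensional
functions; the translation is a bijection onto the latter.\<close>

definition flatten :: "nat \<Rightarrow> nat \<Rightarrow> (nat \<Rightarrow> nat set \<Rightarrow> nat) \<Rightarrow> nat \<times> nat set \<Rightarrow> nat" where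
  "flatten m n c = restrict (\<lambda>x. c (fst x) (snd x)) (items m n)"

definition colouring_space :: "nat \<Rightarrow> nat \<Rightarrow> nat \<Rightarrow> (nat \<Rightarrow> nat set \<Rightarrow> nat) set" where
  "colouring_space m n r = PiE_dflt {1..m} (\<lambda>_. 0) (\<lambda>_. PiE_dflt (edges n) 0 (\<lambda>_. {1..r}))"

lemma random_colourings_uniform:
  assumes "r > 0"
  shows "random_colourings m n r = pmf_of_set (colouring_space m n r)"
    and "finite (colouring_space m n r)" "colouring_space m n r \<noteq> {}"
proof -
  have r: "{1..r} \<noteq> {}" using assms by auto
  have 1: "random_colouring n r = pmf_of_set (PiE_dflt (edges n) 0 (\<lambda>_. {1..r}))"
    unfolding random_colouring_def using r by (intro Pi_pmf_of_set) auto
  have fin: "finite (PiE_dflt (edges n) 0 (\<lambda>_. {1..r}))" by (intro finite_PiE_dflt) auto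
  have ne: "PiE_dflt (edges n) 0 (\<lambda>_. {1..r}) \<noteq> {}" using r by simp
  show "random_colourings m n r = pmf_of_set (colouring_space m n r)"
    unfolding random_colourings_def 1 colouring_space_def using fin ne by (intro Pi_pmf_of_set) auto
  show "finite (colouring_space m n r)"
    unfolding colouring_space_def using fin by (intro finite_PiE_dflt) auto
  show "colouring_space m n r \<noteq> {}" unfolding colouring_space_def using ne by simp
qed

lemma bij_betw_flatten: "bij_betw (flatten m n) (colouring_space m n r) (items m n \<rightarrow>\<^sub>E {1..r})"
proof (rule bij_betw_byWitness[where f' = "\<lambda>d i e. if (i, e) \<in> items m n then d (i, e) else 0"])
  show "\<forall>c\<in>colouring_space m n r. (\<lambda>i e. if (i, e) \<in> items m n then flatten m n c (i, e) else 0) = c"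
    by (auto simp: colouring_space_def PiE_dflt_def flatten_def items_def fun_eq_iff)
  show "\<forall>d\<in>items m n \<rightarrow>\<^sub>E {1..r}. flatten m n (\<lambda>i e. if (i, e) \<in> items m n then d (i, e) else 0) = d"
    by (auto simp: flatten_def fun_eq_iff PiE_def extensional_def)
  show "flatten m n ` colouring_space m n r \<subseteq> items m n \<rightarrow>\<^sub>E {1..r}"
  proof (intro image_subsetI)
    fix c assume "c \<in> colouring_space m n r"
    then have "c i e \<in> {1..r}" if "(i, e) \<in> items m n" for i e
      using that unfolding colouring_space_def PiE_dflt_def items_def by blast
    then show "flatten m n c \<in> items m n \<rightarrow>\<^sub>E {1..r}"
      unfolding flatten_def by (intro restrict_PiE_iff[THEN iffD2]) auto
  qed
  show "(\<lambda>d i e. if (i, e) \<in> items m n then d (i, e) else 0) ` (items m n \<rightarrow>\<^sub>E {1..r}) \<subseteq> colouring_space m n r"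
    by (auto simp: colouring_space_def PiE_dflt_def items_def PiE_iff fun_eq_iff)
qed

lemma rainbow_stacking_iff:
  assumes "c \<in> colouring_space m n r"
  shows "rainbow_stacking m n c \<sigma> \<longleftrightarrow> restrict \<sigma> {1..m} \<in> stackings m n \<and>
    flatten m n c \<in> rainbow_set m n r (restrict \<sigma> {1..m})"
proof (cases "\<forall>i\<in>{1..m}. \<sigma> i permutes {1..n}")
  case False
  then show ?thesis by (auto simp: rainbow_stacking_def stackings_def)
next
  case True
  let ?\<sigma> = "restrict \<sigma> {1..m}"
  have perm: "\<sigma> i permutes {1..n}" if "i \<in> {1..m}" for i using True that by blast
  have st: "?\<sigma> \<in> stackings m n" using True by (auto simp: stackings_def)
  have fl: "flatten m n c \<in> items m n \<rightarrow>\<^sub>E {1..r}"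
    using bij_betwE[OF bij_betw_flatten] assms by blast
  have "(\<forall>e\<in>edges n. inj_on (\<lambda>i. c i (inv (\<sigma> i) ` e)) {1..m}) \<longleftrightarrow> flatten m n c \<in> rainbow_set m n r ?\<sigma>"
  proof
    assume inj: "\<forall>e\<in>edges n. inj_on (\<lambda>i. c i (inv (\<sigma> i) ` e)) {1..m}"
    have "flatten m n c x \<noteq> flatten m n c y"
      if x: "x \<in> items m n" and y: "y \<in> items m n" and ne: "x \<noteq> y" and eq: "position ?\<sigma> x = position ?\<sigma> y" for x y
    proof -
      obtain i a j b where xy: "x = (i, a)" "y = (j, b)" "i \<in> {1..m}" "j \<in> {1..m}" "a \<in> edges n" "b \<in> edges n"
        using x y by (auto simp: items_def)
      define e where "e = \<sigma> i ` a"
      have e: "e \<in> edges n" using True xy by (auto simp: e_def intro: permutes_image_edges)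
      have ab: "a = inv (\<sigma> i) ` e" "b = inv (\<sigma> j) ` e"
        using eq xy(1-4) permutes_image_inv(2)[OF perm[OF xy(3)], of a] permutes_image_inv(2)[OF perm[OF xy(4)], of b]
        by (simp_all add: e_def position_def)
      have "i \<noteq> j" using ne xy ab by auto
      then have "c i (inv (\<sigma> i) ` e) \<noteq> c j (inv (\<sigma> j) ` e)"
        using inj_onD[OF bspec[OF inj e], of i j] xy(3,4) by blast
      then show ?thesis using x y xy ab by (simp add: flatten_def)
    qed
    then show "flatten m n c \<in> rainbow_set m n r ?\<sigma>"
      using fl by (auto simp: proper_colourings_def)
  next
    assume proper: "flatten m n c \<in> rainbow_set m n r ?\<sigma>"
    show "\<forall>e\<in>edges n. inj_on (\<lambda>i. c i (inv (\<sigma> i) ` e)) {1..m}"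
    proof (intro ballI inj_onI)
      fix e i j
      assume e: "e \<in> edges n" and i: "i \<in> {1..m}" and j: "j \<in> {1..m}"
        and eq: "c i (inv (\<sigma> i) ` e) = c j (inv (\<sigma> j) ` e)"
      let ?x = "(i, inv (\<sigma> i) ` e)" and ?y = "(j, inv (\<sigma> j) ` e)"
      have it: "?x \<in> items m n" "?y \<in> items m n"
        using True e i j by (auto simp: items_def intro!: permutes_image_edges permutes_inv)
      have pos: "position ?\<sigma> ?x = position ?\<sigma> ?y"
        using i j permutes_image_inv(1)[OF perm[OF i], of e] permutes_image_inv(1)[OF perm[OF j], of e]
        by (simp add: position_def)
      have "flatten m n c ?x = flatten m n c ?y" using it eq by (simp add: flatten_def)
      then have "?x = ?y"
      proof (rule inj_onD[OF proper_colourings_inj_on_class(1)[OF proper]])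
        show "?x \<in> {y\<in>items m n. position ?\<sigma> y = position ?\<sigma> ?y}"
          "?y \<in> {y\<in>items m n. position ?\<sigma> y = position ?\<sigma> ?y}"
          using it pos by blast+
      qed
      then show "i = j" by simp
    qed
  qed
  then show ?thesis using st True by (simp add: rainbow_stacking_def)
qed

text \<open>The only passage from probabilities to counting.\<close>

lemma prob_rainbow_stacking:
  assumes "r > 0"
  shows "measure_pmf.prob (random_colourings m n r) {c. \<exists>\<sigma>. rainbow_stacking m n c \<sigma>} =
    real (card {d \<in> items m n \<rightarrow>\<^sub>E {1..r}. \<exists>\<sigma>\<in>stackings m n. d \<in> rainbow_set m n r \<sigma>}) / real r ^ card (items m n)"
proof -
  let ?\<Omega> = "colouring_space m n r" and ?D = "items m n \<rightarrow>\<^sub>E {1..r}"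
  let ?Q = "\<lambda>d. \<exists>\<sigma>\<in>stackings m n. d \<in> rainbow_set m n r \<sigma>"
  have iff: "(\<exists>\<sigma>. rainbow_stacking m n c \<sigma>) \<longleftrightarrow> ?Q (flatten m n c)" if c: "c \<in> ?\<Omega>" for c
  proof
    assume "?Q (flatten m n c)"
    then obtain \<sigma> where \<sigma>: "\<sigma> \<in> stackings m n" "flatten m n c \<in> rainbow_set m n r \<sigma>" by blast
    moreover have "restrict \<sigma> {1..m} = \<sigma>" using \<sigma>(1) by (auto simp: stackings_def)
    ultimately show "\<exists>\<sigma>. rainbow_stacking m n c \<sigma>" using rainbow_stacking_iff[OF c, of \<sigma>] by auto
  qed (use rainbow_stacking_iff[OF c] in blast)
  have bij: "bij_betw (flatten m n) ?\<Omega> ?D" by (rule bij_betw_flatten)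
  have "flatten m n ` {c\<in>?\<Omega>. ?Q (flatten m n c)} = {d\<in>?D. ?Q d}"
  proof (intro equalityI subsetI)
    fix d assume d: "d \<in> {d\<in>?D. ?Q d}"
    then have "d \<in> flatten m n ` ?\<Omega>" using bij_betw_imp_surj_on[OF bij] by simp
    then obtain c where "c \<in> ?\<Omega>" "d = flatten m n c" by blast
    then show "d \<in> flatten m n ` {c\<in>?\<Omega>. ?Q (flatten m n c)}" using d by blast
  qed (use bij in \<open>auto simp: bij_betw_def simp del: One_nat_def\<close>)
  then have "card {d\<in>?D. ?Q d} = card {c\<in>?\<Omega>. ?Q (flatten m n c)}"
    using bij by (metis (no_types, lifting) bij_betw_def card_image inj_on_subset mem_Collect_eq subsetI)
  also have "{c\<in>?\<Omega>. ?Q (flatten m n c)} = ?\<Omega> \<inter> {c. \<exists>\<sigma>. rainbow_stacking m n c \<sigma>}"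
    using iff by blast
  finally have num: "card (?\<Omega> \<inter> {c. \<exists>\<sigma>. rainbow_stacking m n c \<sigma>}) = card {d\<in>?D. ?Q d}" by simp
  have "card ?\<Omega> = card ?D" using bij by (rule bij_betw_same_card)
  also have "\<dots> = r ^ card (items m n)" by (simp add: card_PiE)
  finally have den: "card ?\<Omega> = r ^ card (items m n)" .
  show ?thesis
    unfolding random_colourings_uniform(1)[OF assms] measure_pmf_of_set[OF random_colourings_uniform(3,2)[OF assms]]
    by (simp add: num den)
qed

section \<open>First and second moments\<close>

text \<open>Applying one permutation of the vertices to all positions keeps a stacking rainbow, so the
first coordinate can be made trivial. This saves a factor \<open>fact n\<close> in the union bound.\<close>

lemma rainbow_set_normalise:
  assumes "\<sigma> \<in> stackings m n" "m \<ge> 1" "d \<in> rainbow_set m n r \<sigma>"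
  shows "\<exists>\<tau>\<in>stackings m n. \<tau> 1 = id \<and> d \<in> rainbow_set m n r \<tau>"
proof -
  have one: "1 \<in> {1..m}" using assms(2) by simp
  note p = stackingsD[OF assms(1) one]
  define \<tau> where "\<tau> = restrict (\<lambda>i. inv (\<sigma> 1) \<circ> \<sigma> i) {1..m}"
  have \<tau>: "\<tau> \<in> stackings m n"
    unfolding \<tau>_def stackings_def
    by (intro restrict_PiE_iff[THEN iffD2] ballI CollectI permutes_compose[OF stackingsD[OF assms(1)] permutes_inv[OF p]])
  have pos: "position \<tau> x = inv (\<sigma> 1) ` position \<sigma> x" if "x \<in> items m n" for x
    using that by (auto simp: position_def \<tau>_def items_def image_comp)
  have "position \<tau> x = position \<tau> y \<longleftrightarrow> position \<sigma> x = position \<sigma> y"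
    if "x \<in> items m n" "y \<in> items m n" for x y
    using permutes_image_inv(1)[OF p] pos that by metis
  then have "d \<in> rainbow_set m n r \<tau>" using assms(3) by (simp add: proper_colourings_def)
  moreover have "\<tau> 1 = id" using one permutes_inv_o(2)[OF p] by (simp add: \<tau>_def)
  ultimately show ?thesis using \<tau> by blast
qed

lemma card_normalised_stackings:
  assumes "m \<ge> 1"
  shows "card {\<tau>\<in>stackings m n. \<tau> 1 = id} = fact n ^ (m - 1)"
proof -
  have ins: "{1..m} = insert 1 {2..m}" using assms by auto
  have "{\<tau>\<in>stackings m n. \<tau> 1 = id} = PiE {1..m} (\<lambda>i. if i = 1 then {id} else {p. p permutes {1..n}})"
    (is "?L = ?R")
  proof (intro equalityI subsetI)
    fix \<tau> assume "\<tau> \<in> ?L"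
    then show "\<tau> \<in> ?R" by (auto simp: stackings_def PiE_iff)
  next
    fix \<tau> assume \<tau>: "\<tau> \<in> ?R"
    have "\<tau> i permutes {1..n}" if "i \<in> {1..m}" for i
      using PiE_mem[OF \<tau> that] by (auto split: if_splits simp: permutes_id)
    moreover have "\<tau> 1 = id" using PiE_mem[OF \<tau>, of 1] assms by simp
    ultimately show "\<tau> \<in> ?L" using \<tau> by (auto simp: stackings_def PiE_iff)
  qed
  then have "card {\<tau>\<in>stackings m n. \<tau> 1 = id}
      = (\<Prod>i\<in>{1..m}. card (if i = 1 then {id} else {p. p permutes {1..n}}))"
    by (simp add: card_PiE)
  also have "\<dots> = (\<Prod>i\<in>{2..m}. card {p. p permutes {1..n}})"
    unfolding ins by (subst prod.insert) (auto intro!: prod.cong)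
  also have "\<dots> = fact n ^ (m - 1)" by (simp add: card_permutations)
  finally show ?thesis .
qed

lemma prob_rainbow_stacking_le:
  assumes "r > 0" "m \<ge> 1"
  shows "measure_pmf.prob (random_colourings m n r) {c. \<exists>\<sigma>. rainbow_stacking m n c \<sigma>}
    \<le> fact n ^ (m - 1) * birthday r m ^ (n choose 2)"
proof -
  let ?D = "items m n \<rightarrow>\<^sub>E {1..r}" and ?T = "{\<tau>\<in>stackings m n. \<tau> 1 = id}"
  have "{d \<in> ?D. \<exists>\<sigma>\<in>stackings m n. d \<in> rainbow_set m n r \<sigma>} \<subseteq> (\<Union>\<tau>\<in>?T. rainbow_set m n r \<tau>)"
    using rainbow_set_normalise[OF _ assms(2)] by fast
  then have "card {d \<in> ?D. \<exists>\<sigma>\<in>stackings m n. d \<in> rainbow_set m n r \<sigma>} \<le> card (\<Union>\<tau>\<in>?T. rainbow_set m n r \<tau>)"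
    by (intro card_mono) auto
  also have "\<dots> \<le> (\<Sum>\<tau>\<in>?T. card (rainbow_set m n r \<tau>))" by (intro card_UN_le) auto
  finally have "real (card {d \<in> ?D. \<exists>\<sigma>\<in>stackings m n. d \<in> rainbow_set m n r \<sigma>})
      \<le> (\<Sum>\<tau>\<in>?T. real (card (rainbow_set m n r \<tau>)))"
    unfolding of_nat_sum[symmetric] of_nat_le_iff .
  also have "\<dots> = (\<Sum>\<tau>\<in>?T. real r ^ card (items m n) * birthday r m ^ (n choose 2))"
    using assms(1) by (intro sum.cong refl card_rainbow_set) auto
  also have "\<dots> = fact n ^ (m - 1) * birthday r m ^ (n choose 2) * real r ^ card (items m n)"
    unfolding sum_constant card_normalised_stackings[OF assms(2)] by simp
  finally show ?thesis
    unfolding prob_rainbow_stacking[OF assms(1)] using assms(1) by (simp add: divide_le_eq)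
qed

text \<open>Chebyshev's inequality for the number \<open>N d\<close> of sets \<open>R s\<close> that contain \<open>d\<close>, whose mean is \<open>M\<close>.\<close>

lemma card_avoiding_le:
  fixes R :: "'s \<Rightarrow> 'd set" and K \<delta> :: real
  assumes "finite D" "finite S" "\<And>s. s \<in> S \<Longrightarrow> R s \<subseteq> D" "\<And>s. s \<in> S \<Longrightarrow> real (card (R s)) = K"
    and "S \<noteq> {}" "K > 0"
    and second: "(\<Sum>s\<in>S. \<Sum>t\<in>S. real (card (R s \<inter> R t))) \<le> (1 + \<delta>) * (real (card S) * K)\<^sup>2 / real (card D)"
  shows "real (card {d\<in>D. \<forall>s\<in>S. d \<notin> R s}) \<le> \<delta> * real (card D)"
proof -
  define N where "N d = (\<Sum>s\<in>S. of_bool (d \<in> R s) :: real)" for d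
  define M where "M = real (card S) * K / real (card D)"
  have cS: "card S > 0" using assms by (simp add: card_gt_0_iff)
  obtain s where s: "s \<in> S" using assms(5) by blast
  have "card (R s) > 0" using assms(4)[OF s] assms(6) by linarith
  then have cD: "card D > 0" using card_mono[OF assms(1) assms(3)[OF s]] by linarith
  have M0: "M > 0" using cS cD assms(6) by (simp add: M_def)
  have count: "(\<Sum>d\<in>D. of_bool (d \<in> A) :: real) = real (card A)" if "A \<subseteq> D" for A
    using that assms(1) by (simp add: sum.If_cases of_bool_def Int_absorb1)
  have "(\<Sum>d\<in>D. N d) = (\<Sum>s\<in>S. \<Sum>d\<in>D. of_bool (d \<in> R s))"
    unfolding N_def by (rule sum.swap)
  also have "\<dots> = (\<Sum>s\<in>S. K)" using assms(3,4) by (intro sum.cong refl) (simp add: count)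
  finally have N1: "(\<Sum>d\<in>D. N d) = M * real (card D)" using cD by (simp add: M_def)
  have "(\<Sum>d\<in>D. (N d)\<^sup>2) = (\<Sum>d\<in>D. \<Sum>s\<in>S. \<Sum>t\<in>S. of_bool (d \<in> R s \<inter> R t))"
    unfolding N_def power2_eq_square sum_product by (intro sum.cong refl) auto
  also have "\<dots> = (\<Sum>s\<in>S. \<Sum>t\<in>S. \<Sum>d\<in>D. of_bool (d \<in> R s \<inter> R t))"
    by (subst sum.swap) (intro sum.cong refl sum.swap)
  also have "\<dots> = (\<Sum>s\<in>S. \<Sum>t\<in>S. real (card (R s \<inter> R t)))"
    using assms(3) by (intro sum.cong refl count) auto
  also have "\<dots> \<le> (1 + \<delta>) * (real (card S) * K)\<^sup>2 / real (card D)" by (rule second)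
  also have "\<dots> = (1 + \<delta>) * M\<^sup>2 * real (card D)"
    using cD by (simp add: M_def power2_eq_square)
  finally have N2: "(\<Sum>d\<in>D. (N d)\<^sup>2) \<le> (1 + \<delta>) * M\<^sup>2 * real (card D)" .
  let ?Z = "{d\<in>D. \<forall>s\<in>S. d \<notin> R s}"
  have "M\<^sup>2 * real (card ?Z) = (\<Sum>d\<in>?Z. (N d - M)\<^sup>2)" by (simp add: N_def)
  also have "\<dots> \<le> (\<Sum>d\<in>D. (N d - M)\<^sup>2)" using assms(1) by (intro sum_mono2) auto
  also have "\<dots> = (\<Sum>d\<in>D. (N d)\<^sup>2) - 2 * M * (\<Sum>d\<in>D. N d) + M\<^sup>2 * real (card D)"
  proof -
    have "(\<Sum>d\<in>D. (N d - M)\<^sup>2) = (\<Sum>d\<in>D. (N d)\<^sup>2 - 2 * M * N d + M\<^sup>2)"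
      by (intro sum.cong refl) (simp add: power2_diff)
    then show ?thesis by (simp add: sum.distrib sum_subtractf sum_distrib_left[symmetric])
  qed
  also have "\<dots> \<le> M\<^sup>2 * (\<delta> * real (card D))"
    using N2 unfolding N1 by (simp add: algebra_simps power2_eq_square)
  finally show ?thesis using M0 by simp
qed

text \<open>The number of target edges \<open>e\<close> for which the colours that coordinates \<open>i\<close> and \<open>j\<close> of \<open>\<sigma>\<close> place on \<open>e\<close> are
also placed on a common edge by \<open>\<tau>\<close>.\<close>

definition coincidences :: "(nat \<Rightarrow> nat \<Rightarrow> nat) \<Rightarrow> (nat \<Rightarrow> nat \<Rightarrow> nat) \<Rightarrow> nat \<Rightarrow> nat \<Rightarrow> nat \<Rightarrow> nat" where
  "coincidences \<sigma> \<tau> n i j =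
     card {e\<in>edges n. \<tau> i ` (inv (\<sigma> i) ` e) = \<tau> j ` (inv (\<sigma> j) ` e)}"

text \<open>Both sides count ordered pairs of parallel edges of the multigraph formed by \<open>\<sigma>\<close> and \<open>\<tau>\<close>. Two colours of the
same coordinate are never parallel.\<close>

lemma sum_pairs_coincidences:
  assumes "\<sigma> \<in> stackings m n" "\<tau> \<in> stackings m n"
  defines "k \<equiv> \<lambda>v. real (card {x\<in>items m n. (position \<sigma> x, position \<tau> x) = v})"
  shows "(\<Sum>v\<in>edges n \<times> edges n. k v * (k v - 1)) =
    (\<Sum>i\<in>{1..m}. \<Sum>j\<in>{1..m} - {i}. real (coincidences \<sigma> \<tau> n i j))"
proof -
  define \<rho> where "\<rho> i e = \<tau> i ` (inv (\<sigma> i) ` e)" for i e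
  have \<rho>: "\<rho> i e \<in> edges n" if "i \<in> {1..m}" "e \<in> edges n" for i e
    unfolding \<rho>_def using that assms(1,2)
    by (intro permutes_image_edges permutes_inv stackingsD)
  have k: "k (e, f) = (\<Sum>i\<in>{1..m}. of_bool (\<rho> i e = f))" if "e \<in> edges n" for e f
  proof -
    have "{x\<in>items m n. (position \<sigma> x, position \<tau> x) = (e, f)}
        = {x\<in>(\<lambda>i. (i, inv (\<sigma> i) ` e)) ` {1..m}. position \<tau> x = f}"
      using position_class[OF assms(1) that] by blast
    also have "\<dots> = (\<lambda>i. (i, inv (\<sigma> i) ` e)) ` {i\<in>{1..m}. \<rho> i e = f}"
      by (auto simp: position_def \<rho>_def)
    finally have "k (e, f) = real (card {i\<in>{1..m}. \<rho> i e = f})"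
      unfolding k_def by (simp add: card_image inj_on_def)
    then show ?thesis by (simp add: of_bool_def sum.If_cases Int_def)
  qed
  have kk: "k (e, f) * (k (e, f) - 1) = (\<Sum>i\<in>{1..m}. \<Sum>j\<in>{1..m} - {i}. of_bool (\<rho> i e = f \<and> \<rho> j e = f))"
    if "e \<in> edges n" for e f
  proof -
    have "k (e, f) * k (e, f) = (\<Sum>i\<in>{1..m}. \<Sum>j\<in>{1..m}. of_bool (\<rho> i e = f \<and> \<rho> j e = f))"
      unfolding k[OF that] sum_product by (intro sum.cong refl) auto
    also have "\<dots> = (\<Sum>i\<in>{1..m}. of_bool (\<rho> i e = f) + (\<Sum>j\<in>{1..m} - {i}. of_bool (\<rho> i e = f \<and> \<rho> j e = f)))"
      by (intro sum.cong refl) (subst sum.remove, auto)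
    also have "\<dots> = k (e, f) + (\<Sum>i\<in>{1..m}. \<Sum>j\<in>{1..m} - {i}. of_bool (\<rho> i e = f \<and> \<rho> j e = f))"
      by (simp add: sum.distrib k[OF that])
    finally show ?thesis by (simp add: algebra_simps)
  qed
  have one: "(\<Sum>f\<in>edges n. of_bool (\<rho> i e = f \<and> \<rho> j e = f)) = (of_bool (\<rho> i e = \<rho> j e) :: real)"
    if "i \<in> {1..m}" "e \<in> edges n" for i j e
  proof -
    have "(\<Sum>f\<in>edges n. of_bool (\<rho> i e = f \<and> \<rho> j e = f))
        = (\<Sum>f\<in>edges n. if \<rho> i e = f then (of_bool (\<rho> i e = \<rho> j e) :: real) else 0)"
      by (intro sum.cong refl) auto
    then show ?thesis using \<rho>[OF that] by simp
  qed
  have "(\<Sum>v\<in>edges n \<times> edges n. k v * (k v - 1)) = (\<Sum>e\<in>edges n. \<Sum>f\<in>edges n. k (e, f) * (k (e, f) - 1))"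
    by (simp add: sum.cartesian_product case_prod_unfold)
  also have "\<dots> = (\<Sum>e\<in>edges n. \<Sum>f\<in>edges n. \<Sum>i\<in>{1..m}. \<Sum>j\<in>{1..m} - {i}. of_bool (\<rho> i e = f \<and> \<rho> j e = f))"
    using kk by (intro sum.cong refl) auto
  also have "\<dots> = (\<Sum>e\<in>edges n. \<Sum>i\<in>{1..m}. \<Sum>f\<in>edges n. \<Sum>j\<in>{1..m} - {i}. of_bool (\<rho> i e = f \<and> \<rho> j e = f))"
    by (intro sum.cong refl sum.swap)
  also have "\<dots> = (\<Sum>e\<in>edges n. \<Sum>i\<in>{1..m}. \<Sum>j\<in>{1..m} - {i}. \<Sum>f\<in>edges n. of_bool (\<rho> i e = f \<and> \<rho> j e = f))"
    by (intro sum.cong refl sum.swap)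
  also have "\<dots> = (\<Sum>e\<in>edges n. \<Sum>i\<in>{1..m}. \<Sum>j\<in>{1..m} - {i}. of_bool (\<rho> i e = \<rho> j e))"
    using one by (intro sum.cong refl) auto
  also have "\<dots> = (\<Sum>i\<in>{1..m}. \<Sum>e\<in>edges n. \<Sum>j\<in>{1..m} - {i}. of_bool (\<rho> i e = \<rho> j e))"
    by (rule sum.swap)
  also have "\<dots> = (\<Sum>i\<in>{1..m}. \<Sum>j\<in>{1..m} - {i}. \<Sum>e\<in>edges n. of_bool (\<rho> i e = \<rho> j e))"
    by (intro sum.cong refl sum.swap)
  also have "\<dots> = (\<Sum>i\<in>{1..m}. \<Sum>j\<in>{1..m} - {i}. real (coincidences \<sigma> \<tau> n i j))"
    by (intro sum.cong refl) (simp add: coincidences_def \<rho>_def of_bool_def sum.If_cases Int_def)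
  finally show ?thesis .
qed

text \<open>Multiplying a uniformly random permutation by fixed ones on both sides keeps it uniform.\<close>

lemma fixed_edge_sum_twist:
  assumes "p permutes {1..n}" "q permutes {1..n}"
  shows "(\<Sum>\<pi> | \<pi> permutes {1..n}. exp (l * real (card {e\<in>edges n. p ` e = \<pi> ` (q ` e)}))) = fixed_edge_sum n l"
proof -
  have "p ` e = \<pi> ` (q ` e) \<longleftrightarrow> (inv p \<circ> \<pi> \<circ> q) ` e = e" for \<pi> e
    using permutes_image_eq_iff[OF assms(1), of e "\<pi> ` (q ` e)"] by (auto simp: image_comp comp_assoc)
  then have "(\<Sum>\<pi> | \<pi> permutes {1..n}. exp (l * real (card {e\<in>edges n. p ` e = \<pi> ` (q ` e)})))
      = (\<Sum>\<pi> | \<pi> permutes {1..n}. exp (l * real (card {e\<in>edges n. (inv p \<circ> \<pi> \<circ> q) ` e = e})))"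
    by simp
  also have "\<dots> = (\<Sum>\<pi> | \<pi> permutes {1..n}. exp (l * real (card {e\<in>edges n. (\<pi> \<circ> q) ` e = e})))"
    by (rule setum_permutations_compose_left[OF permutes_inv[OF assms(1)], symmetric,
          of "\<lambda>\<pi>. exp (l * real (card {e\<in>edges n. (\<pi> \<circ> q) ` e = e}))"])
  also have "\<dots> = fixed_edge_sum n l"
    unfolding fixed_edge_sum_def
    by (rule sum_permutations_compose_right[OF assms(2), symmetric,
          of "\<lambda>\<pi>. exp (l * real (card {e\<in>edges n. \<pi> ` e = e}))"])
  finally show ?thesis .
qed

text \<open>Once \<open>\<tau> i\<close> is given, the number of coincidences between \<open>i\<close> and \<open>j\<close> depends only on \<open>\<tau> j\<close>, so the sum factorises,
and each factor is the sum over fixed edges of one permutation.\<close>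

lemma star_sum:
  assumes \<sigma>: "\<sigma> \<in> stackings m n" and i: "i \<in> {1..m}"
  shows "(\<Sum>\<tau>\<in>stackings m n. \<Prod>j\<in>{1..m} - {i}. exp (l * real (coincidences \<sigma> \<tau> n i j)))
    = fact n * fixed_edge_sum n l ^ (m - 1)"
proof -
  let ?P = "{p. p permutes {1..n}}"
  define h where "h q j p = exp (l * real (card {e\<in>edges n. q ` (inv (\<sigma> i) ` e) = p ` (inv (\<sigma> j) ` e)}))"
    for q p :: "nat \<Rightarrow> nat" and j
  have finP: "finite ?P" by (simp add: finite_permutations)
  \<comment> \<open>With the value of \<open>\<tau> i\<close> prescribed, the stackings still form a product set, so sum and product can be exchanged.\<close>
  have fibre: "{\<tau>\<in>stackings m n. \<tau> i = q} = PiE {1..m} (\<lambda>j. if j = i then {q} else ?P)"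
    if q: "q \<in> ?P" for q
  proof (intro equalityI subsetI)
    fix \<tau> assume "\<tau> \<in> {\<tau>\<in>stackings m n. \<tau> i = q}"
    then show "\<tau> \<in> PiE {1..m} (\<lambda>j. if j = i then {q} else ?P)" by (auto simp: stackings_def PiE_iff)
  next
    fix \<tau> assume \<tau>: "\<tau> \<in> PiE {1..m} (\<lambda>j. if j = i then {q} else ?P)"
    have "\<tau> j permutes {1..n}" if "j \<in> {1..m}" for j
      using PiE_mem[OF \<tau> that] q by (auto split: if_splits)
    moreover have "\<tau> i = q" using PiE_mem[OF \<tau> i] by simp
    ultimately show "\<tau> \<in> {\<tau>\<in>stackings m n. \<tau> i = q}" using \<tau> by (auto simp: stackings_def PiE_iff)
  qed
  have inner: "(\<Sum>\<tau>\<in>{\<tau>\<in>stackings m n. \<tau> i = q}. \<Prod>j\<in>{1..m} - {i}. h q j (\<tau> j)) = fixed_edge_sum n l ^ (m - 1)"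
    if q: "q \<in> ?P" for q
  proof -
    have "(\<Sum>\<tau>\<in>{\<tau>\<in>stackings m n. \<tau> i = q}. \<Prod>j\<in>{1..m} - {i}. h q j (\<tau> j))
        = (\<Sum>\<tau>\<in>PiE {1..m} (\<lambda>j. if j = i then {q} else ?P). \<Prod>j\<in>{1..m}. if j = i then 1 else h q j (\<tau> j))"
      unfolding fibre[OF q] using i by (intro sum.cong refl) (simp add: prod.remove[of _ i])
    also have "\<dots> = (\<Prod>j\<in>{1..m}. \<Sum>p\<in>(if j = i then {q} else ?P). if j = i then 1 else h q j p)"
      using finP by (intro prod_sum_PiE[symmetric]) auto
    also have "\<dots> = (\<Prod>j\<in>{1..m} - {i}. \<Sum>p\<in>?P. h q j p)"
      using i by (simp add: prod.remove[of _ i])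
    also have "\<dots> = (\<Prod>j\<in>{1..m} - {i}. fixed_edge_sum n l)"
    proof (intro prod.cong refl)
      fix j assume j: "j \<in> {1..m} - {i}"
      have "(\<Sum>p\<in>?P. h q j p)
          = (\<Sum>p\<in>?P. exp (l * real (card {e\<in>edges n. (q \<circ> inv (\<sigma> i)) ` e = p ` (inv (\<sigma> j) ` e)})))"
        by (simp add: h_def image_comp)
      also have "\<dots> = fixed_edge_sum n l"
        using q i j by (intro fixed_edge_sum_twist permutes_compose permutes_inv stackingsD[OF \<sigma>]) auto
      finally show "(\<Sum>p\<in>?P. h q j p) = fixed_edge_sum n l" .
    qed
    finally show ?thesis using i by simp
  qed
  have "(\<Sum>\<tau>\<in>stackings m n. \<Prod>j\<in>{1..m} - {i}. exp (l * real (coincidences \<sigma> \<tau> n i j)))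
      = (\<Sum>q\<in>?P. \<Sum>\<tau>\<in>{\<tau>\<in>stackings m n. \<tau> i = q}. \<Prod>j\<in>{1..m} - {i}. exp (l * real (coincidences \<sigma> \<tau> n i j)))"
    using finP stackingsD[OF _ i, of _ n] by (intro sum.group[symmetric] finite_stackings) blast+
  also have "\<dots> = (\<Sum>q\<in>?P. fixed_edge_sum n l ^ (m - 1))"
  proof (intro sum.cong refl)
    fix q assume q: "q \<in> ?P"
    show "(\<Sum>\<tau>\<in>{\<tau>\<in>stackings m n. \<tau> i = q}. \<Prod>j\<in>{1..m} - {i}. exp (l * real (coincidences \<sigma> \<tau> n i j)))
        = fixed_edge_sum n l ^ (m - 1)"
      unfolding inner[OF q, symmetric] by (intro sum.cong refl prod.cong) (auto simp: h_def coincidences_def)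
  qed
  also have "\<dots> = fact n * fixed_edge_sum n l ^ (m - 1)" by (simp add: card_permutations)
  finally show ?thesis .
qed

text \<open>The exponent is a sum over all pairs of coordinates, whose factors are not independent. It equals the average over \<open>i\<close> of
\<open>l\<close> times the sum over the star with centre \<open>i\<close>, and by convexity of \<open>exp\<close> it suffices to treat
a single star. Since \<open>m * (m - 1)\<close> pairs with weight \<open>1 / m\<close> amount to \<open>m - 1\<close> edges of a star with
weight one, nothing is lost when all coordinates agree, the extreme case.\<close>

lemma overlap_sum_le:
  assumes \<sigma>: "\<sigma> \<in> stackings m n" and m: "m \<ge> 1" "4 * m \<le> r"
  shows "(\<Sum>\<tau>\<in>stackings m n. 1 / (\<Prod>v\<in>edges n \<times> edges n.
      birthday r (card {x\<in>items m n. (position \<sigma> x, position \<tau> x) = v})))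
    \<le> fact n * fixed_edge_sum n (pair_weight m r) ^ (m - 1)"
proof -
  define l where "l = pair_weight m r"
  have single: "1 / (\<Prod>v\<in>edges n \<times> edges n. birthday r (card {x\<in>items m n. (position \<sigma> x, position \<tau> x) = v}))
      \<le> (\<Sum>i\<in>{1..m}. 1 / m * (\<Prod>j\<in>{1..m} - {i}. exp (l * real (coincidences \<sigma> \<tau> n i j))))"
    if \<tau>: "\<tau> \<in> stackings m n" for \<tau>
  proof -
    define k where "k v = card {x\<in>items m n. (position \<sigma> x, position \<tau> x) = v}" for v
    have km: "k v \<le> m" if "v \<in> edges n \<times> edges n" for v
    proof -
      have "k v \<le> card {x\<in>items m n. position \<sigma> x = fst v}" unfolding k_def by (intro card_mono) auto
      then show ?thesis using card_position_class[OF \<sigma>, of "fst v"] that by auto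
    qed
    have "1 / (\<Prod>v\<in>edges n \<times> edges n. birthday r (k v)) = (\<Prod>v\<in>edges n \<times> edges n. 1 / birthday r (k v))"
      by (simp add: prod_dividef)
    also have "\<dots> \<le> (\<Prod>v\<in>edges n \<times> edges n. exp (l / m * (real (k v) * (real (k v) - 1))))"
      unfolding l_def using km m
      by (intro prod_mono conjI inverse_birthday_le) (auto intro!: less_imp_le[OF birthday_pos] order.trans[OF km])
    also have "\<dots> = exp (l / m * (\<Sum>v\<in>edges n \<times> edges n. real (k v) * (real (k v) - 1)))"
      by (simp add: exp_sum sum_distrib_left)
    also have "\<dots> = exp (\<Sum>i\<in>{1..m}. (1 / m) *\<^sub>R (\<Sum>j\<in>{1..m} - {i}. l * real (coincidences \<sigma> \<tau> n i j)))"
      unfolding k_def sum_pairs_coincidences[OF \<sigma> \<tau>] by (simp add: sum_distrib_left)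
    also have "\<dots> \<le> (\<Sum>i\<in>{1..m}. 1 / m * exp (\<Sum>j\<in>{1..m} - {i}. l * real (coincidences \<sigma> \<tau> n i j)))"
      using m by (intro convex_on_sum[OF _ _ exp_convex]) auto
    also have "\<dots> = (\<Sum>i\<in>{1..m}. 1 / m * (\<Prod>j\<in>{1..m} - {i}. exp (l * real (coincidences \<sigma> \<tau> n i j))))"
      by (simp add: exp_sum)
    finally show ?thesis by (simp add: k_def)
  qed
  have "(\<Sum>\<tau>\<in>stackings m n. 1 / (\<Prod>v\<in>edges n \<times> edges n.
      birthday r (card {x\<in>items m n. (position \<sigma> x, position \<tau> x) = v})))
    \<le> (\<Sum>\<tau>\<in>stackings m n. \<Sum>i\<in>{1..m}. 1 / m * (\<Prod>j\<in>{1..m} - {i}. exp (l * real (coincidences \<sigma> \<tau> n i j))))"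
    by (intro sum_mono single)
  also have "\<dots> = (\<Sum>i\<in>{1..m}. 1 / m * (\<Sum>\<tau>\<in>stackings m n. \<Prod>j\<in>{1..m} - {i}. exp (l * real (coincidences \<sigma> \<tau> n i j))))"
    by (subst sum.swap) (simp only: sum_distrib_left)
  also have "\<dots> = (\<Sum>i\<in>{1..m}. 1 / m * (fact n * fixed_edge_sum n l ^ (m - 1)))"
    using star_sum[OF \<sigma>] by (intro sum.cong refl) auto
  also have "\<dots> = fact n * fixed_edge_sum n l ^ (m - 1)" using m by simp
  finally show ?thesis by (simp add: l_def)
qed

text \<open>The second moment method. The left side of the hypothesis bounds the ratio of the second moment of the
number of rainbow stackings to the square of its mean.\<close>

lemma prob_rainbow_stacking_ge:
  assumes m: "m \<ge> 1" "4 * m \<le> r"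
    and \<delta>: "(1 + 8 * real m ^ 3 / real r ^ 3) ^ (m * (n choose 2))
      * (fixed_edge_sum n (pair_weight m r) / fact n) ^ (m - 1) \<le> 1 + \<delta>"
  shows "1 - \<delta> \<le> measure_pmf.prob (random_colourings m n r) {c. \<exists>\<sigma>. rainbow_stacking m n c \<sigma>}"
proof -
  let ?D = "items m n \<rightarrow>\<^sub>E {1..r}" and ?S = "stackings m n"
  define I where "I = card (items m n)"
  define q where "q = birthday r m ^ (n choose 2)"
  define c where "c = (1 + 8 * real m ^ 3 / real r ^ 3) ^ I"
  define ov where "ov \<sigma> \<tau> = 1 / (\<Prod>v\<in>edges n \<times> edges n.
      birthday r (card {x\<in>items m n. (position \<sigma> x, position \<tau> x) = v}))" for \<sigma> \<tau>
  have r0: "r > 0" using m by simp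
  have I: "I = m * (n choose 2)" by (simp add: I_def card_items)
  have q0: "q > 0" using m by (simp add: q_def birthday_pos)
  have c0: "c \<ge> 0" by (simp add: c_def)
  have cD: "real (card ?D) = real r ^ I" by (simp add: card_PiE I_def)
  have cD0: "card ?D > 0" using cD r0 by (metis of_nat_0_less_iff zero_less_power)
  have pair: "real (card (rainbow_set m n r \<sigma> \<inter> rainbow_set m n r \<tau>)) \<le> real r ^ I * q\<^sup>2 * c * ov \<sigma> \<tau>"
    if \<sigma>: "\<sigma> \<in> ?S" and \<tau>: "\<tau> \<in> ?S" for \<sigma> \<tau>
  proof -
    have class_le: "card {y\<in>items m n. position \<upsilon> y = position \<upsilon> x} \<le> m"
      if "\<upsilon> \<in> ?S" "x \<in> items m n" for \<upsilon> x
      using card_position_class[OF that(1), of "position \<upsilon> x"] position_items[OF that(1)] that(2) by auto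
    have prod_q: "(\<Prod>e\<in>edges n. birthday r (card {x\<in>items m n. position \<upsilon> x = e})) = q"
      if "\<upsilon> \<in> ?S" for \<upsilon>
      using card_position_class[OF that] by (simp add: q_def card_edges)
    have "rainbow_set m n r \<sigma> \<inter> rainbow_set m n r \<tau> = proper_colourings (position \<sigma>) (position \<tau>) r (items m n)"
      by (auto simp: proper_colourings_def)
    then have "real (card (rainbow_set m n r \<sigma> \<inter> rainbow_set m n r \<tau>)) \<le> real r ^ I * (q * q /
        (\<Prod>v\<in>edges n \<times> edges n. birthday r (card {x\<in>items m n. (position \<sigma> x, position \<tau> x) = v}))) * c"
      using card_proper_colourings_pair_le[OF _ _ _ position_items[OF \<sigma>] position_items[OF \<tau>] m(2)]
        m class_le \<sigma> \<tau> prod_q by (simp add: I_def c_def)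
    then show ?thesis by (simp add: ov_def power2_eq_square mult_ac)
  qed
  have "(\<Sum>\<sigma>\<in>?S. \<Sum>\<tau>\<in>?S. real (card (rainbow_set m n r \<sigma> \<inter> rainbow_set m n r \<tau>)))
      \<le> (\<Sum>\<sigma>\<in>?S. \<Sum>\<tau>\<in>?S. real r ^ I * q\<^sup>2 * c * ov \<sigma> \<tau>)"
    by (intro sum_mono pair)
  also have "\<dots> = real r ^ I * q\<^sup>2 * c * (\<Sum>\<sigma>\<in>?S. \<Sum>\<tau>\<in>?S. ov \<sigma> \<tau>)"
    by (simp add: sum_distrib_left)
  also have "\<dots> \<le> real r ^ I * q\<^sup>2 * c * (\<Sum>\<sigma>\<in>?S. fact n * fixed_edge_sum n (pair_weight m r) ^ (m - 1))"
    unfolding ov_def using m c0 by (intro mult_left_mono sum_mono overlap_sum_le) auto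
  also have "\<dots> = real r ^ I * q\<^sup>2 * (fact n ^ m)\<^sup>2 * (c * (fixed_edge_sum n (pair_weight m r) / fact n) ^ (m - 1))"
  proof -
    obtain m' where m': "m = Suc m'" using m(1) by (cases m) auto
    show ?thesis by (simp add: card_stackings m' power_divide field_simps power2_eq_square)
  qed
  also have "\<dots> \<le> real r ^ I * q\<^sup>2 * (fact n ^ m)\<^sup>2 * (1 + \<delta>)"
    using \<delta> unfolding c_def I by (intro mult_left_mono) auto
  also have "\<dots> = (1 + \<delta>) * (real (card ?S) * (real r ^ I * q))\<^sup>2 / real (card ?D)"
    unfolding cD using r0 by (simp add: card_stackings power2_eq_square field_simps)
  finally have second: "(\<Sum>\<sigma>\<in>?S. \<Sum>\<tau>\<in>?S. real (card (rainbow_set m n r \<sigma> \<inter> rainbow_set m n r \<tau>)))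
      \<le> (1 + \<delta>) * (real (card ?S) * (real r ^ I * q))\<^sup>2 / real (card ?D)" .
  have S_ne: "?S \<noteq> {}" using card_stackings[of m n] by (metis card.empty fact_nonzero power_not_zero)
  have avoid: "real (card {d\<in>?D. \<forall>\<sigma>\<in>?S. d \<notin> rainbow_set m n r \<sigma>}) \<le> \<delta> * real (card ?D)"
  proof (rule card_avoiding_le[where R = "rainbow_set m n r", OF _ _ _ _ S_ne _ second])
    show "finite ?D" by (simp add: finite_PiE)
    show "rainbow_set m n r \<sigma> \<subseteq> ?D" for \<sigma> by (auto simp: proper_colourings_def)
    show "real (card (rainbow_set m n r \<sigma>)) = real r ^ I * q" if "\<sigma> \<in> ?S" for \<sigma>
      using card_rainbow_set[OF that r0] by (simp add: I_def q_def)
  qed (use r0 q0 in auto)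
  have "{d\<in>?D. \<exists>\<sigma>\<in>?S. d \<in> rainbow_set m n r \<sigma>} = ?D - {d\<in>?D. \<forall>\<sigma>\<in>?S. d \<notin> rainbow_set m n r \<sigma>}" by blast
  then have "card {d\<in>?D. \<exists>\<sigma>\<in>?S. d \<in> rainbow_set m n r \<sigma>} + card {d\<in>?D. \<forall>\<sigma>\<in>?S. d \<notin> rainbow_set m n r \<sigma>} = card ?D"
    by (simp add: card_Diff_subset finite_PiE card_mono)
  then have "(1 - \<delta>) * real (card ?D) \<le> real (card {d\<in>?D. \<exists>\<sigma>\<in>?S. d \<in> rainbow_set m n r \<sigma>})"
    using avoid by (simp add: algebra_simps)
  then show ?thesis
    unfolding prob_rainbow_stacking[OF r0] using cD cD0 r0 by (simp add: I_def pos_le_divide_eq)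
qed

section \<open>The threshold\<close>

text \<open>The critical number of colours, up to a bounded error.\<close>

definition threshold :: "nat \<Rightarrow> nat \<Rightarrow> real" where
  "threshold m n = real m * real (n choose 2) / (2 * ln (fact n))"

lemma ln_fact_pos:
  assumes "n \<ge> 2"
  shows "0 < ln (fact n :: real)"
proof -
  have "(fact 2 :: real) \<le> fact n" using assms by (intro fact_mono) auto
  then show ?thesis by simp
qed

lemma ln_fact_le_mult_ln:
  assumes "n \<ge> 2"
  shows "ln (fact n) \<le> real n * ln (real n)"
proof -
  have "ln (fact n) \<le> (real n - 1) * ln (real n)" using assms by (intro ln_fact_le) auto
  also have "\<dots> \<le> real n * ln (real n)" using assms by (intro mult_right_mono) auto
  finally show ?thesis .
qed

lemma threshold_ge:
  assumes "n \<ge> 2"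
  shows "real m * ((real n - 1) / (4 * ln (real n))) \<le> threshold m n"
proof -
  have ln: "0 < ln (real n)" using assms by simp
  have "ln (fact n) \<le> real n * ln (real n)"
    using assms by (rule ln_fact_le_mult_ln)
  then have "real m * (real n * (real n - 1) / 2) / (2 * (real n * ln (real n))) \<le> threshold m n"
    unfolding threshold_def real_choose_2 using ln_fact_pos[OF assms] assms
    by (intro divide_left_mono mult_left_mono) auto
  also have "real m * (real n * (real n - 1) / 2) / (2 * (real n * ln (real n))) = real m * ((real n - 1) / (4 * ln (real n)))"
    using assms ln by (simp add: field_simps)
  finally show ?thesis .
qed

lemma threshold_at_top:
  assumes "m \<ge> 1"
  shows "filterlim (threshold m) at_top sequentially"
proof (rule filterlim_at_top_mono)
  have "filterlim (\<lambda>n::nat. (real n - 1) / (4 * ln (real n))) at_top sequentially" by real_asymp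
  then show "filterlim (\<lambda>n::nat. real m * ((real n - 1) / (4 * ln (real n)))) at_top sequentially"
    using assms by (intro filterlim_tendsto_pos_mult_at_top[OF tendsto_const]) auto
  show "\<forall>\<^sub>F n in sequentially. real m * ((real n - 1) / (4 * ln (real n))) \<le> threshold m n"
    using eventually_ge_at_top[of 2] by eventually_elim (rule threshold_ge)
qed

text \<open>All errors in the expansion of the exponents are bounded by multiples of this quantity.\<close>

lemma ln_fact_over_threshold_squared:
  assumes "m \<ge> 1"
  shows "(\<lambda>n. ln (fact n) / (threshold m n)\<^sup>2) \<longlonglongrightarrow> 0"
proof (rule tendsto_sandwich[OF _ _ tendsto_const])
  show "\<forall>\<^sub>F n in sequentially. 0 \<le> ln (fact n) / (threshold m n)\<^sup>2" by simp
  show "(\<lambda>n::nat. real n * ln (real n) / ((real n - 1) / (4 * ln (real n)))\<^sup>2) \<longlonglongrightarrow> 0" by real_asymp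
  show "\<forall>\<^sub>F n in sequentially. ln (fact n) / (threshold m n)\<^sup>2
      \<le> real n * ln (real n) / ((real n - 1) / (4 * ln (real n)))\<^sup>2"
    using eventually_ge_at_top[of 2]
  proof eventually_elim
    case (elim n)
    have ln: "0 < ln (real n)" using elim by simp
    then have p: "0 < (real n - 1) / (4 * ln (real n))" using elim by simp
    have "1 * ((real n - 1) / (4 * ln (real n))) \<le> real m * ((real n - 1) / (4 * ln (real n)))"
      using p assms by (intro mult_right_mono) auto
    also have "\<dots> \<le> threshold m n" by (rule threshold_ge[OF elim])
    finally have "(real n - 1) / (4 * ln (real n)) \<le> threshold m n" by simp
    then have "((real n - 1) / (4 * ln (real n)))\<^sup>2 \<le> (threshold m n)\<^sup>2"
      using p by (intro power_mono) auto
    moreover have "ln (fact n) \<le> real n * ln (real n)"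
      using elim by (rule ln_fact_le_mult_ln)
    ultimately show ?case using p elim ln by (intro frac_le) auto
  qed
qed

text \<open>An excess \<open>\<epsilon>\<close> of colours over the threshold changes the exponents by about \<open>\<epsilon>\<close> times the
right side. This is why the window has width of order \<open>1 / (ln n)\<^sup>2\<close>.\<close>

lemma ln_fact_over_threshold_ge:
  assumes "m \<ge> 1"
  shows "\<forall>\<^sub>F n in sequentially. (ln (real n))\<^sup>2 / real m \<le> ln (fact n) / threshold m n"
proof -
  have "\<forall>\<^sub>F n::nat in sequentially. real n * ln (real n) / 2 \<le> real n * ln (real n) - real n" by real_asymp
  then show ?thesis using eventually_ge_at_top[of 2]
  proof eventually_elim
    case (elim n)
    define L where "L = ln (fact n :: real)"
    have L: "L > 0" using ln_fact_pos elim by (simp add: L_def)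
    have ln: "0 < ln (real n)" using elim by simp
    have E: "real (n choose 2) > 0" using elim by (simp add: real_choose_2)
    have "real n * ln (real n) / 2 \<le> L" using elim ln_fact_ge[of n] unfolding L_def by linarith
    then have "(real n * ln (real n) / 2)\<^sup>2 \<le> L\<^sup>2" using ln by (intro power_mono) auto
    moreover have "(ln (real n))\<^sup>2 * real (n choose 2) \<le> 2 * (real n * ln (real n) / 2)\<^sup>2"
      using elim ln by (simp add: real_choose_2 power2_eq_square mult_left_mono field_simps)
    ultimately have "(ln (real n))\<^sup>2 * real (n choose 2) \<le> 2 * L\<^sup>2" by linarith
    then have "(ln (real n))\<^sup>2 \<le> 2 * L\<^sup>2 / real (n choose 2)" using E by (subst pos_le_divide_eq)
    then have "(ln (real n))\<^sup>2 / real m \<le> 2 * L\<^sup>2 / real (n choose 2) / real m" by (rule divide_right_mono) simp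
    also have "\<dots> = L / threshold m n" using L E assms by (simp add: threshold_def L_def[symmetric] field_simps power2_eq_square)
    finally show ?case by (simp add: L_def)
  qed
qed

text \<open>Multiplied by \<open>m - 1\<close>, the left side bounds the logarithm of the expected number of normalised rainbow stackings;
it is monotone in \<open>x\<close>, so \<open>x\<close> may be replaced by its upper bound \<open>R\<close>. By the choice of \<open>c\<close>, the difference
\<open>1 - r0 / R - r0 * c / R\<^sup>2\<close> is \<open>- \<epsilon> / R\<close> up to an error of order \<open>1 / R\<^sup>2\<close>.\<close>

lemma subcritical_exponent_le:
  fixes L r0 c \<epsilon> x K :: real
  assumes "0 < x" "x \<le> r0 + c - \<epsilon>" "0 \<le> \<epsilon>" "\<epsilon> \<le> 1" "0 \<le> c" "c \<le> r0" "2 \<le> r0" "0 \<le> L" "K \<le> L / r0"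
  shows "L - L * r0 * (1 / x + c / x\<^sup>2) \<le> - (K * \<epsilon> / 2) + 4 * c\<^sup>2 * (L / r0\<^sup>2)"
proof -
  define R where "R = r0 + c - \<epsilon>"
  have R: "0 < R" "r0 / 2 \<le> R" "R \<le> 2 * r0" using assms by (auto simp: R_def)
  have "1 / R + c / R\<^sup>2 \<le> 1 / x + c / x\<^sup>2"
    using assms R by (intro add_mono divide_left_mono power_mono) (auto simp: R_def)
  then have "L * r0 * (1 / R + c / R\<^sup>2) \<le> L * r0 * (1 / x + c / x\<^sup>2)"
    using assms by (intro mult_left_mono) auto
  then have "L - L * r0 * (1 / x + c / x\<^sup>2) \<le> L - L * r0 * (1 / R + c / R\<^sup>2)" by simp
  also have "\<dots> = L * (R\<^sup>2 - r0 * R - r0 * c) / R\<^sup>2"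
    using R by (simp add: field_simps power2_eq_square)
  also have "R\<^sup>2 - r0 * R - r0 * c = c\<^sup>2 - \<epsilon> * R - c * \<epsilon>"
    by (simp add: R_def power2_eq_square algebra_simps)
  also have "L * (c\<^sup>2 - \<epsilon> * R - c * \<epsilon>) / R\<^sup>2 \<le> L * (c\<^sup>2 - \<epsilon> * R) / R\<^sup>2"
    using assms by (intro divide_right_mono mult_left_mono) auto
  also have "\<dots> = c\<^sup>2 * (L / R\<^sup>2) - L / R * \<epsilon>"
    using R by (simp add: field_simps power2_eq_square)
  also have "\<dots> \<le> c\<^sup>2 * (L / (r0 / 2)\<^sup>2) - L / (2 * r0) * \<epsilon>"
    using R assms by (intro diff_mono mult_left_mono mult_right_mono divide_left_mono power_mono) auto
  also have "\<dots> = 4 * c\<^sup>2 * (L / r0\<^sup>2) - (L / r0) * \<epsilon> / 2"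
    by (simp add: power_divide)
  also have "\<dots> \<le> 4 * c\<^sup>2 * (L / r0\<^sup>2) - K * \<epsilon> / 2"
    using assms by (intro diff_mono divide_right_mono mult_right_mono) auto
  finally show ?thesis by simp
qed

text \<open>The same computation above the threshold, for \<open>pair_weight\<close> times the number of edges. The term with \<open>d\<close>
is the third order of the weight.\<close>

lemma supercritical_exponent_le:
  fixes L r0 c \<epsilon> x K d :: real
  assumes "r0 + c + \<epsilon> \<le> x" "0 \<le> \<epsilon>" "\<epsilon> \<le> 1" "0 \<le> c" "c + 1 \<le> r0" "0 \<le> L" "K \<le> L / r0" "0 \<le> d"
  shows "L * r0 * (1 / x + c / x\<^sup>2 + d / x ^ 3) \<le> L - (K * \<epsilon> / 2 - d * (L / r0\<^sup>2))"
proof -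
  define R where "R = r0 + c + \<epsilon>"
  have R: "0 < R" "r0 \<le> R" "R \<le> 2 * r0" "0 < r0" using assms by (auto simp: R_def)
  have "1 / x + c / x\<^sup>2 + d / x ^ 3 \<le> 1 / R + c / R\<^sup>2 + d / R ^ 3"
    using assms R by (intro add_mono divide_left_mono power_mono) (auto simp: R_def)
  then have "L * r0 * (1 / x + c / x\<^sup>2 + d / x ^ 3) \<le> L * r0 * (1 / R + c / R\<^sup>2 + d / R ^ 3)"
    using assms R by (intro mult_left_mono) auto
  also have "\<dots> = L - L * (R\<^sup>2 - r0 * R - r0 * c) / R\<^sup>2 + d * (L * (r0 / R ^ 3))"
    using R by (simp add: field_simps power2_eq_square power3_eq_cube)
  also have "R\<^sup>2 - r0 * R - r0 * c = \<epsilon> * R + c * (c + \<epsilon>)"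
    by (simp add: R_def power2_eq_square algebra_simps)
  also have "L - L * (\<epsilon> * R + c * (c + \<epsilon>)) / R\<^sup>2 + d * (L * (r0 / R ^ 3))
      \<le> L - L * (\<epsilon> * R) / R\<^sup>2 + d * (L * (r0 / r0 ^ 3))"
    using R assms by (intro add_mono diff_mono divide_right_mono mult_left_mono divide_left_mono power_mono) auto
  also have "\<dots> = L - L / R * \<epsilon> + d * (L / r0\<^sup>2)"
    using R by (simp add: power2_eq_square power3_eq_cube)
  also have "\<dots> \<le> L - L / (2 * r0) * \<epsilon> + d * (L / r0\<^sup>2)"
    using R assms by (intro add_mono diff_mono mult_right_mono divide_left_mono) auto
  also have "\<dots> = L - (L / r0) * \<epsilon> / 2 + d * (L / r0\<^sup>2)" by simp
  also have "\<dots> \<le> L - K * \<epsilon> / 2 + d * (L / r0\<^sup>2)"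
    using assms by (intro add_mono diff_mono divide_right_mono mult_right_mono) auto
  finally show ?thesis by simp
qed

text \<open>Truncating \<open>\<omega>\<close> keeps the shift \<open>\<epsilon> = \<omega> n / (ln n)\<^sup>2\<close> at most one; it only weakens the assumption on \<open>r\<close>.\<close>

lemma min_ln_squared_at_top:
  assumes "filterlim \<omega> at_top sequentially"
  shows "filterlim (\<lambda>n. min (\<omega> n) ((ln (real n))\<^sup>2)) at_top sequentially"
  unfolding filterlim_at_top
proof
  fix Z :: real
  have "filterlim (\<lambda>n::nat. (ln (real n))\<^sup>2) at_top sequentially" by real_asymp
  then have "\<forall>\<^sub>F n::nat in sequentially. Z \<le> (ln (real n))\<^sup>2" by (simp add: filterlim_at_top)
  moreover have "\<forall>\<^sub>F n in sequentially. Z \<le> \<omega> n" using assms by (simp add: filterlim_at_top)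
  ultimately show "\<forall>\<^sub>F n in sequentially. Z \<le> min (\<omega> n) ((ln (real n))\<^sup>2)" by eventually_elim simp
qed

lemma choose_2_eq_threshold:
  assumes "n \<ge> 2"
  shows "real m * real (n choose 2) = 2 * ln (fact n) * threshold m n"
  using ln_fact_pos[OF assms] by (simp add: threshold_def)

text \<open>The first moment method: the expected number of normalised rainbow stackings tends to zero.\<close>

lemma subcritical:
  fixes m :: nat and \<omega> :: "nat \<Rightarrow> real" and r :: "nat \<Rightarrow> nat"
  assumes m: "m \<ge> 2" and \<omega>: "filterlim \<omega> at_top sequentially" and r0: "\<And>n. r n > 0"
    and r: "\<forall>\<^sub>F n in sequentially. real (r n) \<le> threshold m n + (2 * real m - 1) / 6 - \<omega> n / (ln (real n))\<^sup>2"
  shows "(\<lambda>n. measure_pmf.prob (random_colourings m n (r n)) {c. \<exists>\<sigma>. rainbow_stacking m n c \<sigma>}) \<longlonglongrightarrow> 0"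
proof -
  define c where "c = (2 * real m - 1) / 6"
  define \<omega>' where "\<omega>' n = min (\<omega> n) ((ln (real n))\<^sup>2)" for n
  define x where "x n = - (\<omega>' n / (2 * real m)) + 4 * c\<^sup>2 * (ln (fact n) / (threshold m n)\<^sup>2)" for n
  have m1: "m \<ge> 1" using m by simp
  have c0: "0 \<le> c" using m by (simp add: c_def)
  have \<omega>': "filterlim \<omega>' at_top sequentially" unfolding \<omega>'_def by (rule min_ln_squared_at_top[OF \<omega>])
  have ev: "\<forall>\<^sub>F n in sequentially. 0 \<le> \<omega>' n" "\<forall>\<^sub>F n in sequentially. max c 2 \<le> threshold m n"
    using \<omega>' threshold_at_top[OF m1] unfolding filterlim_at_top by blast+
  have bound: "\<forall>\<^sub>F n in sequentially.
      measure_pmf.prob (random_colourings m n (r n)) {c. \<exists>\<sigma>. rainbow_stacking m n c \<sigma>} \<le> exp ((real m - 1) * x n)"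
    using r ev ln_fact_over_threshold_ge[OF m1] eventually_ge_at_top[of 2]
  proof (eventually_elim, goal_cases)
    case (1 n)
    define L where "L = ln (fact n :: real)"
    define T where "T = threshold m n"
    define \<rho> where "\<rho> = real (r n)"
    define \<epsilon> where "\<epsilon> = \<omega>' n / (ln (real n))\<^sup>2"
    have ln: "0 < ln (real n)" using 1 by simp
    have \<epsilon>: "0 \<le> \<epsilon>" "\<epsilon> \<le> 1" "\<epsilon> \<le> \<omega> n / (ln (real n))\<^sup>2"
      using 1 ln by (auto simp: \<epsilon>_def \<omega>'_def divide_le_eq intro: divide_right_mono)
    have \<rho>: "0 < \<rho>" "\<rho> \<le> T + c - \<epsilon>" using r0[of n] 1 \<epsilon>(3) by (auto simp: \<rho>_def T_def c_def)
    have "L - L * T * (1 / \<rho> + c / \<rho>\<^sup>2) \<le> - ((ln (real n))\<^sup>2 / real m * \<epsilon> / 2) + 4 * c\<^sup>2 * (L / T\<^sup>2)"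
      using 1 \<rho> \<epsilon> c0 ln_fact_pos[of n] by (intro subcritical_exponent_le) (auto simp: L_def T_def)
    also have "(ln (real n))\<^sup>2 / real m * \<epsilon> / 2 = \<omega>' n / (2 * real m)" using ln by (simp add: \<epsilon>_def)
    finally have key: "L - L * T * (1 / \<rho> + c / \<rho>\<^sup>2) \<le> x n" by (simp add: x_def L_def T_def)
    have "measure_pmf.prob (random_colourings m n (r n)) {c. \<exists>\<sigma>. rainbow_stacking m n c \<sigma>}
        \<le> fact n ^ (m - 1) * birthday (r n) m ^ (n choose 2)"
      using r0 m by (intro prob_rainbow_stacking_le) auto
    also have "\<dots> \<le> exp (L * (real m - 1)) *
        exp (- (real m * (real m - 1) / 2 * (1 / \<rho> + c / \<rho>\<^sup>2))) ^ (n choose 2)"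
    proof (intro mult_mono power_mono)
      have "fact n ^ (m - 1) = exp L ^ (m - 1)" by (simp add: L_def)
      also have "\<dots> = exp (L * (real m - 1))" using m by (simp add: exp_of_nat_mult[symmetric] of_nat_diff mult.commute)
      finally show "fact n ^ (m - 1) \<le> exp (L * (real m - 1))" by simp
      show "birthday (r n) m \<le> exp (- (real m * (real m - 1) / 2 * (1 / \<rho> + c / \<rho>\<^sup>2)))"
        using birthday_le[OF r0[of n], of m] by (simp add: \<rho>_def c_def)
      show b0: "0 \<le> birthday (r n) m"
        using r0 by (rule birthday_nonneg)
      show "0 \<le> birthday (r n) m ^ (n choose 2)" using b0 by simp
    qed simp
    also have "\<dots> = exp (L * (real m - 1) + real (n choose 2) * (- (real m * (real m - 1) / 2 * (1 / \<rho> + c / \<rho>\<^sup>2))))"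
      by (simp only: exp_add exp_of_nat_mult)
    also have "L * (real m - 1) + real (n choose 2) * (- (real m * (real m - 1) / 2 * (1 / \<rho> + c / \<rho>\<^sup>2)))
        = (real m - 1) * (L - (real m * real (n choose 2)) / 2 * (1 / \<rho> + c / \<rho>\<^sup>2))"
    proof -
      have "L * (M - 1) + e * (- (M * (M - 1) / 2 * b)) = (M - 1) * (L - (M * e) / 2 * b)" for M e b :: real
        by (simp add: field_simps)
      then show ?thesis .
    qed
    also have "\<dots> = (real m - 1) * (L - L * T * (1 / \<rho> + c / \<rho>\<^sup>2))"
      using choose_2_eq_threshold[of n m] 1 by (simp add: L_def T_def)
    also have "exp ((real m - 1) * (L - L * T * (1 / \<rho> + c / \<rho>\<^sup>2))) \<le> exp ((real m - 1) * x n)"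
      using key m by (simp add: mult_left_mono)
    finally show ?case .
  qed
  have "filterlim (\<lambda>n. \<omega>' n * (1 / (2 * real m))) at_top sequentially"
    using \<omega>' m by (intro filterlim_at_top_mult_tendsto_pos[OF tendsto_const]) auto
  moreover have "(\<lambda>n. - (4 * c\<^sup>2) * (ln (fact n) / (threshold m n)\<^sup>2)) \<longlonglongrightarrow> - (4 * c\<^sup>2) * 0"
    by (intro tendsto_mult_left ln_fact_over_threshold_squared m1)
  ultimately have "filterlim (\<lambda>n. - (4 * c\<^sup>2) * (ln (fact n) / (threshold m n)\<^sup>2) + \<omega>' n * (1 / (2 * real m)))
      at_top sequentially"
    by (intro filterlim_tendsto_add_at_top)
  moreover have "- (4 * c\<^sup>2) * (ln (fact n) / (threshold m n)\<^sup>2) + \<omega>' n * (1 / (2 * real m)) = - x n" for n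
    by (simp add: x_def)
  ultimately have "filterlim x at_bot sequentially" by (simp add: filterlim_uminus_at_bot)
  then have "filterlim (\<lambda>n. (real m - 1) * x n) at_bot sequentially"
    using m by (intro filterlim_tendsto_pos_mult_at_bot[OF tendsto_const]) auto
  then have "(\<lambda>n. exp ((real m - 1) * x n)) \<longlonglongrightarrow> 0" by (rule filterlim_compose[OF exp_at_bot])
  then show ?thesis
    by (rule tendsto_sandwich[OF _ bound tendsto_const, rotated]) simp
qed

text \<open>The second moment method: \<open>l\<close> times the number of edges stays below \<open>ln (fact n) - w n\<close>
with \<open>w\<close> tending to infinity, as the bound on the sum over fixed edges requires.\<close>

lemma supercritical:
  fixes m :: nat and \<omega> :: "nat \<Rightarrow> real" and r :: "nat \<Rightarrow> nat"
  assumes m: "m \<ge> 2" and \<omega>: "filterlim \<omega> at_top sequentially"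
    and r: "\<forall>\<^sub>F n in sequentially. threshold m n + (2 * real m - 1) / 6 + \<omega> n / (ln (real n))\<^sup>2 \<le> real (r n)"
  shows "(\<lambda>n. measure_pmf.prob (random_colourings m n (r n)) {c. \<exists>\<sigma>. rainbow_stacking m n c \<sigma>}) \<longlonglongrightarrow> 1"
proof -
  define c where "c = (2 * real m - 1) / 6"
  define d where "d = 2 * (real m)\<^sup>2"
  define \<omega>' where "\<omega>' n = min (\<omega> n) ((ln (real n))\<^sup>2)" for n
  define l where "l n = pair_weight m (r n)" for n
  define y where "y n = ln (fact n) / (threshold m n)\<^sup>2" for n
  define w where "w n = \<omega>' n / (2 * real m) - d * y n" for n
  have m1: "m \<ge> 1" using m by simp
  have c0: "0 \<le> c" using m by (simp add: c_def)
  have \<omega>': "filterlim \<omega>' at_top sequentially" unfolding \<omega>'_def by (rule min_ln_squared_at_top[OF \<omega>])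
  have ev: "\<forall>\<^sub>F n in sequentially. 0 \<le> \<omega>' n" "\<forall>\<^sub>F n in sequentially. c + 1 + 4 * real m \<le> threshold m n"
    using \<omega>' threshold_at_top[OF m1] unfolding filterlim_at_top by blast+
  have y0: "y \<longlonglongrightarrow> 0" unfolding y_def using m by (intro ln_fact_over_threshold_squared) auto
  have w: "filterlim w at_top sequentially"
  proof -
    have "filterlim (\<lambda>n. \<omega>' n * (1 / (2 * real m))) at_top sequentially"
      using \<omega>' m by (intro filterlim_at_top_mult_tendsto_pos[OF tendsto_const]) auto
    moreover have "(\<lambda>n. - d * y n) \<longlonglongrightarrow> - d * 0" by (intro tendsto_mult_left y0)
    ultimately have "filterlim (\<lambda>n. - d * y n + \<omega>' n * (1 / (2 * real m))) at_top sequentially"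
      by (intro filterlim_tendsto_add_at_top)
    then show ?thesis by (simp add: w_def[abs_def])
  qed
  have rT: "\<forall>\<^sub>F n in sequentially. threshold m n \<le> real (r n) \<and> 4 * m \<le> r n \<and>
      0 \<le> l n \<and> l n * real (n choose 2) \<le> ln (fact n) - w n"
    using r ev ln_fact_over_threshold_ge[OF m1] eventually_ge_at_top[of 2]
  proof (eventually_elim, goal_cases)
    case (1 n)
    define L where "L = ln (fact n :: real)"
    define T where "T = threshold m n"
    define \<rho> where "\<rho> = real (r n)"
    define \<epsilon> where "\<epsilon> = \<omega>' n / (ln (real n))\<^sup>2"
    have ln: "0 < ln (real n)" using 1 by simp
    have \<epsilon>: "0 \<le> \<epsilon>" "\<epsilon> \<le> 1" "\<epsilon> \<le> \<omega> n / (ln (real n))\<^sup>2"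
      using 1 ln by (auto simp: \<epsilon>_def \<omega>'_def divide_le_eq intro: divide_right_mono)
    have \<rho>: "T + c + \<epsilon> \<le> \<rho>" using 1 \<epsilon>(3) by (auto simp: \<rho>_def T_def c_def)
    then have T\<rho>: "T \<le> \<rho>" "4 * real m \<le> \<rho>" using \<epsilon> c0 1 by (auto simp: T_def)
    have l: "l n = real m / 2 * (1 / \<rho> + c / \<rho>\<^sup>2 + d / \<rho> ^ 3)"
      by (simp add: l_def pair_weight_def c_def d_def \<rho>_def distrib_left)
    have "L * T * (1 / \<rho> + c / \<rho>\<^sup>2 + d / \<rho> ^ 3) \<le> L - ((ln (real n))\<^sup>2 / real m * \<epsilon> / 2 - d * (L / T\<^sup>2))"
      using 1 \<rho> \<epsilon> c0 ln_fact_pos[of n] by (intro supercritical_exponent_le) (auto simp: L_def T_def d_def)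
    also have "(ln (real n))\<^sup>2 / real m * \<epsilon> / 2 - d * (L / T\<^sup>2) = w n"
      using ln by (simp add: \<epsilon>_def w_def y_def L_def T_def)
    also have "L * T * (1 / \<rho> + c / \<rho>\<^sup>2 + d / \<rho> ^ 3) = l n * real (n choose 2)"
    proof -
      have "l n * real (n choose 2) = (real m * real (n choose 2)) / 2 * (1 / \<rho> + c / \<rho>\<^sup>2 + d / \<rho> ^ 3)"
        unfolding l by simp
      also have "\<dots> = L * T * (1 / \<rho> + c / \<rho>\<^sup>2 + d / \<rho> ^ 3)"
        using choose_2_eq_threshold[of n m] 1 by (simp add: L_def T_def)
      finally show ?thesis by simp
    qed
    finally have main: "l n * real (n choose 2) \<le> L - w n" .
    have "0 \<le> l n" unfolding l using c0 by (simp add: \<rho>_def d_def)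
    moreover have "4 * m \<le> r n" using T\<rho>(2) unfolding \<rho>_def by linarith
    ultimately show ?case using main T\<rho> by (simp add: L_def T_def \<rho>_def)
  qed
  then have "\<forall>\<^sub>F n in sequentially. 0 \<le> l n \<and> l n * real (n choose 2) \<le> ln (fact n) - w n"
    by eventually_elim simp
  from fixed_edge_sum_asymp[OF w this] obtain u where
    u: "u \<longlonglongrightarrow> 1" "\<forall>\<^sub>F n in sequentially. fixed_edge_sum n (l n) \<le> fact n * u n" by blast
  define z where "z n = exp (16 * real m ^ 3 * y n) * u n ^ (m - 1)" for n
  have "z \<longlonglongrightarrow> exp (16 * real m ^ 3 * 0) * 1 ^ (m - 1)"
    unfolding z_def by (intro tendsto_intros y0 u)
  then have "(\<lambda>n. 1 - (z n - 1)) \<longlonglongrightarrow> 1 - (1 - 1)" by (intro tendsto_intros) simp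
  then have lim: "(\<lambda>n. 1 - (z n - 1)) \<longlonglongrightarrow> 1" by simp
  have lower: "\<forall>\<^sub>F n in sequentially. 1 - (z n - 1)
      \<le> measure_pmf.prob (random_colourings m n (r n)) {c. \<exists>\<sigma>. rainbow_stacking m n c \<sigma>}"
    using rT u(2) ev(2) eventually_ge_at_top[of 2]
  proof eventually_elim
    case (elim n)
    define T where "T = threshold m n"
    define \<rho> where "\<rho> = real (r n)"
    have T: "0 < T" "T \<le> \<rho>" using elim c0 by (auto simp: T_def \<rho>_def)
    have "(1 + 8 * real m ^ 3 / \<rho> ^ 3) ^ (m * (n choose 2)) \<le> exp (8 * real m ^ 3 / \<rho> ^ 3) ^ (m * (n choose 2))"
      using T by (intro power_mono exp_ge_add_one_self) auto
    also have "\<dots> = exp (real m * real (n choose 2) * (8 * real m ^ 3 / \<rho> ^ 3))"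
      by (simp add: exp_of_nat_mult[symmetric])
    also have "\<dots> \<le> exp (real m * real (n choose 2) * (8 * real m ^ 3 / T ^ 3))"
      unfolding exp_le_cancel_iff using T by (intro mult_left_mono divide_left_mono power_mono) auto
    also have "real m * real (n choose 2) * (8 * real m ^ 3 / T ^ 3) = 16 * real m ^ 3 * y n"
      using choose_2_eq_threshold[of n m] elim T(1)
      by (simp add: y_def T_def[symmetric] power2_eq_square power3_eq_cube)
    finally have A: "(1 + 8 * real m ^ 3 / real (r n) ^ 3) ^ (m * (n choose 2)) \<le> exp (16 * real m ^ 3 * y n)"
      by (simp add: \<rho>_def)
    have f0: "0 \<le> fixed_edge_sum n (l n)" by (simp add: fixed_edge_sum_def sum_nonneg)
    have "(fixed_edge_sum n (l n) / fact n) ^ (m - 1) \<le> u n ^ (m - 1)"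
      using elim f0 by (intro power_mono) (auto simp: pos_divide_le_eq mult.commute)
    then have "(1 + 8 * real m ^ 3 / real (r n) ^ 3) ^ (m * (n choose 2))
        * (fixed_edge_sum n (l n) / fact n) ^ (m - 1) \<le> 1 + (z n - 1)"
      using A f0 by (simp add: z_def mult_mono)
    then show ?case using elim m by (intro prob_rainbow_stacking_ge) (auto simp: l_def)
  qed
  show ?thesis
    by (rule tendsto_sandwich[OF lower _ lim tendsto_const]) simp
qed

theorem theorem1p1:
  fixes m :: nat and \<omega> :: "nat \<Rightarrow> real" and r :: "nat \<Rightarrow> nat"
  assumes "m \<ge> 2"
    and "filterlim \<omega> at_top sequentially"
    and "\<And>n. r n > 0"
  shows
    "((\<forall>\<^sub>F n in sequentially.
         real (r n) \<le> real m * real (n choose 2) / (2 * ln (fact n))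
                       + (2 * real m - 1) / 6 - \<omega> n / (ln (real n))\<^sup>2)
       \<longrightarrow> (\<lambda>n. measure_pmf.prob (random_colourings m n (r n))
                  {c. \<not> (\<exists>\<sigma>. rainbow_stacking m n c \<sigma>)}) \<longlonglongrightarrow> 1)
     \<and> ((\<forall>\<^sub>F n in sequentially.
         real (r n) \<ge> real m * real (n choose 2) / (2 * ln (fact n))
                       + (2 * real m - 1) / 6 + \<omega> n / (ln (real n))\<^sup>2)
       \<longrightarrow> (\<lambda>n. measure_pmf.prob (random_colourings m n (r n))
                  {c. \<exists>\<sigma>. rainbow_stacking m n c \<sigma>}) \<longlonglongrightarrow> 1)"
proof (intro conjI impI)
  let ?p = "\<lambda>n. measure_pmf.prob (random_colourings m n (r n)) {c. \<exists>\<sigma>. rainbow_stacking m n c \<sigma>}"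
  assume "\<forall>\<^sub>F n in sequentially. real (r n) \<le> real m * real (n choose 2) / (2 * ln (fact n))
                       + (2 * real m - 1) / 6 - \<omega> n / (ln (real n))\<^sup>2"
  then have "?p \<longlonglongrightarrow> 0" using assms by (intro subcritical) (auto simp: threshold_def)
  then have "(\<lambda>n. 1 - ?p n) \<longlonglongrightarrow> 1 - 0" by (intro tendsto_intros)
  moreover have "measure_pmf.prob (random_colourings m n (r n)) {c. \<not> (\<exists>\<sigma>. rainbow_stacking m n c \<sigma>)} = 1 - ?p n" for n
  proof -
    have "{c. \<not> (\<exists>\<sigma>. rainbow_stacking m n c \<sigma>)} = UNIV - {c. \<exists>\<sigma>. rainbow_stacking m n c \<sigma>}" by auto
    then show ?thesis
      using measure_pmf.prob_compl[of "{c. \<exists>\<sigma>. rainbow_stacking m n c \<sigma>}" "random_colourings m n (r n)"] by simp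
  qed
  ultimately show "(\<lambda>n. measure_pmf.prob (random_colourings m n (r n))
      {c. \<not> (\<exists>\<sigma>. rainbow_stacking m n c \<sigma>)}) \<longlonglongrightarrow> 1" by simp
next
  assume "\<forall>\<^sub>F n in sequentially. real (r n) \<ge> real m * real (n choose 2) / (2 * ln (fact n))
                       + (2 * real m - 1) / 6 + \<omega> n / (ln (real n))\<^sup>2"
  then show "(\<lambda>n. measure_pmf.prob (random_colourings m n (r n)) {c. \<exists>\<sigma>. rainbow_stacking m n c \<sigma>}) \<longlonglongrightarrow> 1"
    using assms by (intro supercritical) (auto simp: threshold_def)
qed

end
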